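(* Let $R$ be a ring and let $M$ be a semisimple right $R$-module. Then $M$ has weakly uniserial dimension if and only if $M$ is a finite direct sum of homogeneous semisimple $R$-modules.
   Context: Rings are associative with identity and modules are unitary right modules. For $R$-modules $A,B$, write $A\rightarrowtail B$ if there is an injective $R$-homomorphism $A\to B$, and $A\not\rightarrowtail B$ otherwise. A module $M$ is weakly uniserial if for any two submodules $N,K$ of $M$, $N\rightarrowtail K$ or $K\rightarrowtail N$. Weakly uniserial dimension: define classes $\xi_\alpha$ of non-zero $R$-modules for ordinals $\alpha\ge 1$ by transfinite induction. $\xi_1$ is the class of non-zero weakly uniserial modules. For $\alpha>1$, $\xi_\alpha$ is the class of non-zero modules $M$ such that every non-zero submodule $N\subsetneq M$ with $M\not\rightarrowtail N$ satisfies $N\in\bigcup_{\beta<\alpha}\xi_\beta$. If $M$ belongs to some $\xi_\alpha$, the least such $\alpha$ is the weakly uniserial dimension $\mathrm{w.dim}(M)$; $\mathrm{w.dim}(0)=0$; a non-zero module belonging to no $\xi_\alpha$ has no weakly uniserial dimension. A semisimple module is homogeneous if it is a (possibly infinite) direct sum of pairwise isomorphic simple modules. *)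

theory Defs
  imports "HOL-Algebra.Algebra"
begin

section \<open>Right modules over a not necessarily commutative ring\<close>

text \<open>
  The library locale \<open>module\<close> is about left modules over commutative rings.  As for the library's
  record \<open>module\<close>, the multiplicative fields inherited from \<open>ring\<close> carry no meaning.
\<close>

record ('m, 'r) rmodule = "'m ring" +
  ract :: "'m \<Rightarrow> 'r \<Rightarrow> 'm" (infixl \<open>\<star>\<index>\<close> 70)

locale right_module = R?: ring R + M?: abelian_group M
  for R :: "('r, 'x) ring_scheme" (structure) and M :: "('m, 'r, 'y) rmodule_scheme" (structure) +
  assumes ract_closed:
      "\<lbrakk>x \<in> carrier M; a \<in> carrier R\<rbrakk> \<Longrightarrow> x \<star>\<^bsub>M\<^esub> a \<in> carrier M"
    and ract_add_left:
      "\<lbrakk>x \<in> carrier M; y \<in> carrier M; a \<in> carrier R\<rbrakk> \<Longrightarrow>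
        (x \<oplus>\<^bsub>M\<^esub> y) \<star>\<^bsub>M\<^esub> a = (x \<star>\<^bsub>M\<^esub> a) \<oplus>\<^bsub>M\<^esub> (y \<star>\<^bsub>M\<^esub> a)"
    and ract_add_right:
      "\<lbrakk>x \<in> carrier M; a \<in> carrier R; b \<in> carrier R\<rbrakk> \<Longrightarrow>
        x \<star>\<^bsub>M\<^esub> (a \<oplus>\<^bsub>R\<^esub> b) = (x \<star>\<^bsub>M\<^esub> a) \<oplus>\<^bsub>M\<^esub> (x \<star>\<^bsub>M\<^esub> b)"
    and ract_assoc:
      "\<lbrakk>x \<in> carrier M; a \<in> carrier R; b \<in> carrier R\<rbrakk> \<Longrightarrow>
        x \<star>\<^bsub>M\<^esub> (a \<otimes>\<^bsub>R\<^esub> b) = (x \<star>\<^bsub>M\<^esub> a) \<star>\<^bsub>M\<^esub> b"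
    and ract_one:
      "x \<in> carrier M \<Longrightarrow> x \<star>\<^bsub>M\<^esub> \<one>\<^bsub>R\<^esub> = x"

definition right_submodule ::
    "('r, 'x) ring_scheme \<Rightarrow> ('m, 'r, 'y) rmodule_scheme \<Rightarrow> 'm set \<Rightarrow> bool" where
  "right_submodule R M N \<longleftrightarrow>
     subgroup N (add_monoid M) \<and> (\<forall>x\<in>N. \<forall>a\<in>carrier R. x \<star>\<^bsub>M\<^esub> a \<in> N)"

definition submod :: "('m, 'r, 'y) rmodule_scheme \<Rightarrow> 'm set \<Rightarrow> ('m, 'r, 'y) rmodule_scheme" where
  "submod M N = M\<lparr>carrier := N\<rparr>"

definition zero_module :: "('m, 'r, 'y) rmodule_scheme \<Rightarrow> bool" where
  "zero_module M \<longleftrightarrow> carrier M = {\<zero>\<^bsub>M\<^esub>}"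

definition rmodule_hom ::
    "('r, 'x) ring_scheme \<Rightarrow> ('m, 'r, 'y) rmodule_scheme \<Rightarrow> ('n, 'r, 'z) rmodule_scheme
      \<Rightarrow> ('m \<Rightarrow> 'n) set" where
  "rmodule_hom R A B =
     {f \<in> carrier A \<rightarrow> carrier B.
        (\<forall>x\<in>carrier A. \<forall>y\<in>carrier A. f (x \<oplus>\<^bsub>A\<^esub> y) = f x \<oplus>\<^bsub>B\<^esub> f y) \<and>
        (\<forall>x\<in>carrier A. \<forall>a\<in>carrier R. f (x \<star>\<^bsub>A\<^esub> a) = f x \<star>\<^bsub>B\<^esub> a)}"

definition embeds ::
    "('r, 'x) ring_scheme \<Rightarrow> ('m, 'r, 'y) rmodule_scheme \<Rightarrow> ('n, 'r, 'z) rmodule_scheme \<Rightarrow> bool" where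
  "embeds R A B \<longleftrightarrow> (\<exists>f\<in>rmodule_hom R A B. inj_on f (carrier A))"

definition rmodule_iso ::
    "('r, 'x) ring_scheme \<Rightarrow> ('m, 'r, 'y) rmodule_scheme \<Rightarrow> ('n, 'r, 'z) rmodule_scheme \<Rightarrow> bool" where
  "rmodule_iso R A B \<longleftrightarrow> (\<exists>f\<in>rmodule_hom R A B. bij_betw f (carrier A) (carrier B))"


section \<open>Direct sums and semisimple modules\<close>

text \<open>
  \<open>M\<close> is the internal direct sum of the family of submodules \<open>(S i)\<^sub>i\<^sub>\<in>\<^sub>I\<close>, with \<open>I\<close> possibly infinite:
  every element is the sum of a unique finitely supported family.  The sum is taken over the
  support because \<^const>\<open>finsum\<close> is trivial on infinite index sets.
\<close>

definition internal_direct_sum ::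
    "('r, 'x) ring_scheme \<Rightarrow> ('m, 'r, 'y) rmodule_scheme \<Rightarrow> 'i set \<Rightarrow> ('i \<Rightarrow> 'm set) \<Rightarrow> bool" where
  "internal_direct_sum R M I S \<longleftrightarrow>
     (\<forall>i\<in>I. right_submodule R M (S i)) \<and>
     (\<forall>x\<in>carrier M. \<exists>!f. f \<in> (\<Pi>\<^sub>E i\<in>I. S i) \<and> finite {i\<in>I. f i \<noteq> \<zero>\<^bsub>M\<^esub>} \<and>
        x = finsum M f {i\<in>I. f i \<noteq> \<zero>\<^bsub>M\<^esub>})"

definition simple_rmodule ::
    "('r, 'x) ring_scheme \<Rightarrow> ('m, 'r, 'y) rmodule_scheme \<Rightarrow> bool" where
  "simple_rmodule R M \<longleftrightarrow>
     right_module R M \<and> \<not> zero_module M \<and>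
     (\<forall>N. right_submodule R M N \<longrightarrow> N = {\<zero>\<^bsub>M\<^esub>} \<or> N = carrier M)"

text \<open>
  The summands of an internal direct sum of simple submodules are nonzero, hence pairwise distinct,
  so such a family can be given as a set of submodules indexed by itself.
\<close>

definition semisimple_rmodule ::
    "('r, 'x) ring_scheme \<Rightarrow> ('m, 'r, 'y) rmodule_scheme \<Rightarrow> bool" where
  "semisimple_rmodule R M \<longleftrightarrow>
     right_module R M \<and>
     (\<exists>\<S>. (\<forall>S\<in>\<S>. simple_rmodule R (submod M S)) \<and> internal_direct_sum R M \<S> (\<lambda>S. S))"

definition homogeneous_semisimple ::
    "('r, 'x) ring_scheme \<Rightarrow> ('m, 'r, 'y) rmodule_scheme \<Rightarrow> bool" where
  "homogeneous_semisimple R M \<longleftrightarrow>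
     right_module R M \<and>
     (\<exists>\<S>. (\<forall>S\<in>\<S>. simple_rmodule R (submod M S)) \<and> internal_direct_sum R M \<S> (\<lambda>S. S) \<and>
          (\<forall>S\<in>\<S>. \<forall>T\<in>\<S>. rmodule_iso R (submod M S) (submod M T)))"


section \<open>Weakly uniserial dimension\<close>

definition weakly_uniserial ::
    "('r, 'x) ring_scheme \<Rightarrow> ('m, 'r, 'y) rmodule_scheme \<Rightarrow> bool" where
  "weakly_uniserial R M \<longleftrightarrow>
     (\<forall>N K. right_submodule R M N \<longrightarrow> right_submodule R M K \<longrightarrow>
        embeds R (submod M N) (submod M K) \<or> embeds R (submod M K) (submod M N))"

text \<open>
  Ordinals are represented by well-order relations, compared by \<open><o\<close>, \<open>\<le>o\<close> and \<open>=o\<close>.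
  A relation with empty field is the ordinal 0, one with a singleton field is the ordinal 1.
  \<open>wu_class R \<alpha> M\<close> says that \<open>M\<close> belongs to the class \<open>\<xi>\<close> with index \<open>\<alpha> \<ge> 1\<close>.
\<close>

context
  notes conj_cong [fundef_cong]
begin

function wu_class ::
    "('r, 'x) ring_scheme \<Rightarrow> 'o rel \<Rightarrow> ('m, 'r, 'y) rmodule_scheme \<Rightarrow> bool" where
  "wu_class R \<alpha> M \<longleftrightarrow>
     Well_order \<alpha> \<and> Field \<alpha> \<noteq> {} \<and> right_module R M \<and> \<not> zero_module M \<and>
     (if \<exists>u. Field \<alpha> = {u} then weakly_uniserial R M
      else \<forall>N. right_submodule R M N \<longrightarrow> N \<noteq> {\<zero>\<^bsub>M\<^esub>} \<longrightarrow> N \<noteq> carrier M \<longrightarrow>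
             \<not> embeds R M (submod M N) \<longrightarrow> (\<exists>\<beta>. \<beta> <o \<alpha> \<and> wu_class R \<beta> (submod M N)))"
  by pat_completeness auto
termination
  by (relation "inv_image ordLess (\<lambda>(R, \<alpha>, M). \<alpha>)") (auto intro: wf_ordLess)

end

declare wu_class.simps [simp del]

definition is_wdim ::
    "('r, 'x) ring_scheme \<Rightarrow> ('m, 'r, 'y) rmodule_scheme \<Rightarrow> 'o rel \<Rightarrow> bool" where
  "is_wdim R M (\<alpha> :: 'o rel) \<longleftrightarrow>
     (if zero_module M then \<alpha> = {}
      else wu_class R \<alpha> M \<and> (\<forall>\<beta> :: 'o rel. wu_class R \<beta> M \<longrightarrow> \<alpha> \<le>o \<beta>))"

text \<open>
  HOL has no type of all ordinals.  Well-orders whose elements are subsets of the ambient type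
  suffice: lemma \<open>has_wdim_if_is_wdim\<close> below shows that a dimension represented by a well-order on any
  type whatsoever is already represented here.
\<close>

definition has_wdim ::
    "('r, 'x) ring_scheme \<Rightarrow> ('m, 'r, 'y) rmodule_scheme \<Rightarrow> bool" where
  "has_wdim R M \<longleftrightarrow> (\<exists>\<alpha> :: 'm set rel. is_wdim R M \<alpha>)"


section \<open>Independence of the type carrying the ordinals\<close>

lemma submod_simps [simp]:
  "carrier (submod M N) = N" "\<zero>\<^bsub>submod M N\<^esub> = \<zero>\<^bsub>M\<^esub>" "(\<oplus>\<^bsub>submod M N\<^esub>) = (\<oplus>\<^bsub>M\<^esub>)"
  "(\<star>\<^bsub>submod M N\<^esub>) = (\<star>\<^bsub>M\<^esub>)" "submod (submod M N) K = submod M K" "submod M (carrier M) = M"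
  by (simp_all add: submod_def)

lemma wu_classD:
  assumes "wu_class R \<alpha> M"
  shows "Well_order \<alpha>" "Field \<alpha> \<noteq> {}" "right_module R M" "\<not> zero_module M"
  using iffD1[OF wu_class.simps assms] by blast+

lemma wu_class_one_iff:
  assumes "Field \<alpha> = {u}"
  shows "wu_class R \<alpha> M \<longleftrightarrow>
    Well_order \<alpha> \<and> right_module R M \<and> \<not> zero_module M \<and> weakly_uniserial R M"
  using assms by (subst wu_class.simps) simp

lemma wu_class_gt_one_iff:
  fixes \<alpha> :: "'o rel"
  assumes "Field \<alpha> \<noteq> {}" "\<nexists>u. Field \<alpha> = {u}"
  shows "wu_class R \<alpha> M \<longleftrightarrow>
    Well_order \<alpha> \<and> right_module R M \<and> \<not> zero_module M \<and>
    (\<forall>N. right_submodule R M N \<longrightarrow> N \<noteq> {\<zero>\<^bsub>M\<^esub>} \<longrightarrow> N \<noteq> carrier M \<longrightarrow>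
      \<not> embeds R M (submod M N) \<longrightarrow> (\<exists>\<beta> :: 'o rel. \<beta> <o \<alpha> \<and> wu_class R \<beta> (submod M N)))"
  using assms by (subst wu_class.simps) simp

lemma wu_class_ordIso:
  fixes \<alpha> :: "'o rel" and \<alpha>' :: "'p rel" and M :: "('m, 'r, 'y) rmodule_scheme"
  assumes "wu_class R \<alpha> M" "\<alpha> =o \<alpha>'"
  shows "wu_class R \<alpha>' M"
  using assms
proof (induction \<alpha> arbitrary: \<alpha>' M rule: wf_induct_rule[OF wf_ordLess])
  case (1 \<alpha>)
  from 1(3) obtain f where wo: "Well_order \<alpha>'" and "BNF_Wellorder_Embedding.iso \<alpha> \<alpha>' f"
    unfolding ordIso_def by blast
  then have bij: "bij_betw f (Field \<alpha>) (Field \<alpha>')" by (simp add: BNF_Wellorder_Embedding.iso_def)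
  have one: "(\<exists>u. Field \<alpha> = {u}) \<longleftrightarrow> (\<exists>u. Field \<alpha>' = {u})"
    using bij_betw_same_card[OF bij] unfolding card_1_singleton_iff[symmetric] by simp
  have ne: "Field \<alpha>' \<noteq> {}"
    using bij wu_classD(2)[OF 1(2)] by (metis bij_betw_empty2)
  have step: "\<exists>\<beta>' :: 'p rel. \<beta>' <o \<alpha>' \<and> wu_class R \<beta>' K" if \<beta>: "\<beta> <o \<alpha>" "wu_class R \<beta> K" for \<beta> :: "'o rel" and K :: "('m, 'r, 'y) rmodule_scheme"
  proof -
    obtain p :: "'p rel" where p: "\<beta> =o p" "p <o \<alpha>'"
      using iffD1[OF internalize_ordLess ordLess_ordIso_trans[OF \<beta>(1) 1(3)]] by blast
    show ?thesis using p(2) 1(1)[OF \<beta> p(1)] by (intro exI conjI)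
  qed
  show ?case
  proof (cases "\<exists>u. Field \<alpha> = {u}")
    case True
    then obtain u where u: "Field \<alpha> = {u}" ..
    from True one have "\<exists>v. Field \<alpha>' = {v}" by (rule iffD1[rotated])
    then obtain v where v: "Field \<alpha>' = {v}" ..
    from 1(2) wo show ?thesis
      unfolding wu_class_one_iff[OF u] wu_class_one_iff[OF v] by simp
  next
    case False
    with one have False': "\<nexists>u. Field \<alpha>' = {u}" by simp
    from 1(2) have "\<exists>\<beta> :: 'o rel. \<beta> <o \<alpha> \<and> wu_class R \<beta> (submod M N)"
      if "right_submodule R M N" "N \<noteq> {\<zero>\<^bsub>M\<^esub>}" "N \<noteq> carrier M" "\<not> embeds R M (submod M N)" for N
      using that unfolding wu_class_gt_one_iff[OF wu_classD(2)[OF 1(2)] False] by simp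
    then have "\<exists>\<beta> :: 'p rel. \<beta> <o \<alpha>' \<and> wu_class R \<beta> (submod M N)"
      if "right_submodule R M N" "N \<noteq> {\<zero>\<^bsub>M\<^esub>}" "N \<noteq> carrier M" "\<not> embeds R M (submod M N)" for N
      using step that by meson
    then show ?thesis
      using wo wu_classD(3,4)[OF 1(2)] by (intro iffD2[OF wu_class_gt_one_iff[OF ne False']] conjI allI impI)
  qed
qed

lemma wu_class_least:
  fixes \<alpha> :: "'o rel"
  assumes "wu_class R \<alpha> M"
  obtains \<gamma> :: "'o rel" where
    "wu_class R \<gamma> M" "\<And>\<beta> :: 'o rel. wu_class R \<beta> M \<Longrightarrow> \<gamma> \<le>o \<beta>" "\<gamma> \<le>o \<alpha>"
proof -
  have wo: "Well_order \<beta>" if "wu_class R \<beta> M" for \<beta> :: "'o rel"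
    using wu_classD(1)[OF that] .
  have "\<exists>\<gamma>\<in>{\<gamma> :: 'o rel. wu_class R \<gamma> M}. \<forall>\<beta>\<in>{\<gamma> :: 'o rel. wu_class R \<gamma> M}. \<gamma> \<le>o \<beta>"
    using exists_minim_Well_order[of "{\<gamma> :: 'o rel. wu_class R \<gamma> M}"] assms wo by blast
  with assms that show thesis by blast
qed

lemma embeds_trans:
  assumes "embeds R A B" "embeds R B C"
  shows "embeds R A C"
proof -
  obtain f g where f: "f \<in> rmodule_hom R A B" "inj_on f (carrier A)"
    and g: "g \<in> rmodule_hom R B C" "inj_on g (carrier B)"
    using assms by (auto simp: embeds_def)
  have fc: "f x \<in> carrier B" if "x \<in> carrier A" for x
    using f(1) that by (auto simp: rmodule_hom_def)
  have "g \<circ> f \<in> rmodule_hom R A C"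
    using f(1) g(1) fc by (auto simp: rmodule_hom_def Pi_iff)
  moreover have "inj_on (g \<circ> f) (carrier A)"
    using f(2) g(2) fc by (auto simp: inj_on_def)
  ultimately show ?thesis by (auto simp: embeds_def)
qed

lemma embeds_submod:
  assumes "N \<subseteq> K"
  shows "embeds R (submod M N) (submod M K)"
  using assms unfolding embeds_def
  by (intro bexI[of _ "\<lambda>x. x"]) (auto simp: rmodule_hom_def)

lemma right_submodule_subset: "right_submodule R M N \<Longrightarrow> N \<subseteq> carrier M"
  using subgroup.subset[of N "add_monoid M"] by (simp add: right_submodule_def)

lemma right_submodule_trans:
  assumes "right_module R M" "right_submodule R M N" "right_submodule R (submod M N) K"
  shows "right_submodule R M K"
proof -
  interpret right_module R M by fact
  have "subgroup K (add_monoid M)"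
    using group.incl_subgroup[OF M.a_group, of N K] assms(2,3)
    by (simp add: right_submodule_def submod_def)
  with assms(3) show ?thesis by (simp add: right_submodule_def)
qed

lemma embeds_zero:
  assumes "right_module R M" "right_submodule R M K"
  shows "embeds R (submod M {\<zero>\<^bsub>M\<^esub>}) (submod M K)"
proof -
  have "\<zero>\<^bsub>M\<^esub> \<in> K"
    using assms(2) subgroup.one_closed[of K "add_monoid M"] by (simp add: right_submodule_def)
  then show ?thesis by (intro embeds_submod) simp
qed

lemma ordLess_image:
  assumes "r <o r'"
  obtains f where "f ` Field r \<subset> Field r'"
proof -
  from assms obtain f where wo: "Well_order r" "Well_order r'" and f: "embed r r' f"
    unfolding ordLess_def embedS_def by blast
  have "f ` Field r \<subseteq> Field r'" using embed_Field[OF f] .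
  with BNF_Wellorder_Constructions.ordLess_Field[OF assms f] that show thesis by blast
qed

lemma wu_class_hit:
  fixes \<alpha> \<beta> :: "'o rel"
  assumes "wu_class R \<alpha> M" "\<And>\<gamma> :: 'o rel. wu_class R \<gamma> M \<Longrightarrow> \<alpha> \<le>o \<gamma>"
    and "\<beta> <o \<alpha>" "Field \<beta> \<noteq> {}"
  shows "\<exists>N. right_submodule R M N \<and> wu_class R \<beta> (submod M N) \<and>
           (\<forall>\<gamma> :: 'o rel. wu_class R \<gamma> (submod M N) \<longrightarrow> \<beta> \<le>o \<gamma>)"
  using assms
proof (induction \<alpha> arbitrary: M rule: wf_induct_rule[OF wf_ordLess])
  case (1 \<alpha>)
  note M = wu_classD(3,4)[OF 1(2)]
  have wo\<beta>: "Well_order \<beta>" using 1(4) unfolding ordLess_def by blast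
  have not\<beta>: "\<not> wu_class R \<beta> M"
    using 1(3)[of \<beta>] 1(4) not_ordLess_ordLeq by blast
  have not_one: "\<not> (\<exists>u. Field \<alpha> = {u})"
  proof
    assume "\<exists>u. Field \<alpha> = {u}"
    then obtain u where u: "Field \<alpha> = {u}" by blast
    obtain f where "f ` Field \<beta> \<subset> Field \<alpha>" using ordLess_image[OF 1(4)] .
    with u 1(5) show False by auto
  qed
  have "\<exists>N. right_submodule R M N \<and> N \<noteq> {\<zero>\<^bsub>M\<^esub>} \<and> N \<noteq> carrier M \<and> \<not> embeds R M (submod M N) \<and>
          (\<forall>\<gamma> :: 'o rel. wu_class R \<gamma> (submod M N) \<longrightarrow> \<not> \<gamma> <o \<beta>)"
  proof (cases "\<exists>u. Field \<beta> = {u}")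
    case False
    show ?thesis
    proof (rule ccontr)
      assume "\<not> ?thesis"
      then have "\<exists>\<gamma> :: 'o rel. \<gamma> <o \<beta> \<and> wu_class R \<gamma> (submod M N)"
        if "right_submodule R M N" "N \<noteq> {\<zero>\<^bsub>M\<^esub>}" "N \<noteq> carrier M" "\<not> embeds R M (submod M N)" for N
        using that by meson
      then have "wu_class R \<beta> M"
        using wo\<beta> M by (intro iffD2[OF wu_class_gt_one_iff[OF 1(5) False]] conjI allI impI)
      with not\<beta> show False ..
    qed
  next
    case True
    then obtain u where u: "Field \<beta> = {u}" by metis
    from not\<beta> wo\<beta> M have "\<not> weakly_uniserial R M"
      unfolding wu_class_one_iff[OF u] by simp
    then obtain N K where NK: "right_submodule R M N" "right_submodule R M K"
      "\<not> embeds R (submod M N) (submod M K)" "\<not> embeds R (submod M K) (submod M N)"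
      unfolding weakly_uniserial_def by blast
    have KM: "embeds R (submod M K) M"
      using embeds_submod[OF right_submodule_subset[OF NK(2)], of R M] by simp
    have "\<not> \<gamma> <o \<beta>" if "wu_class R \<gamma> (submod M N)" for \<gamma> :: "'o rel"
    proof
      assume "\<gamma> <o \<beta>"
      then have "Field \<gamma> = {}"
      proof -
        obtain f where "f ` Field \<gamma> \<subset> Field \<beta>"
          using ordLess_image[OF \<open>\<gamma> <o \<beta>\<close>] .
        with u show ?thesis by auto
      qed
      with wu_classD(2)[OF that] show False by blast
    qed
    moreover have "N \<noteq> {\<zero>\<^bsub>M\<^esub>}" using NK embeds_zero[OF M(1)] by blast
    moreover have "N \<noteq> carrier M" using NK KM by auto
    moreover have "\<not> embeds R M (submod M N)" using NK KM embeds_trans by blast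
    ultimately show ?thesis using NK by blast
  qed
  then obtain N where N: "right_submodule R M N" "N \<noteq> {\<zero>\<^bsub>M\<^esub>}" "N \<noteq> carrier M"
    "\<not> embeds R M (submod M N)" "\<And>\<gamma> :: 'o rel. wu_class R \<gamma> (submod M N) \<Longrightarrow> \<not> \<gamma> <o \<beta>"
    by blast
  have "\<exists>\<delta> :: 'o rel. \<delta> <o \<alpha> \<and> wu_class R \<delta> (submod M N)"
    using 1(2) N(1-4) unfolding wu_class_gt_one_iff[OF wu_classD(2)[OF 1(2)] not_one] by simp
  then obtain \<delta> :: "'o rel" where \<delta>: "\<delta> <o \<alpha>" "wu_class R \<delta> (submod M N)" by blast
  obtain \<gamma> :: "'o rel" where \<gamma>: "wu_class R \<gamma> (submod M N)"
    "\<And>\<beta> :: 'o rel. wu_class R \<beta> (submod M N) \<Longrightarrow> \<gamma> \<le>o \<beta>" "\<gamma> \<le>o \<delta>"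
    using wu_class_least[OF \<delta>(2)] by blast
  have \<gamma>\<alpha>: "\<gamma> <o \<alpha>" using \<gamma>(3) \<delta>(1) ordLeq_ordLess_trans by blast
  have "Well_order \<gamma>" using wu_classD(1)[OF \<gamma>(1)] .
  with N(5)[OF \<gamma>(1)] wo\<beta> have "\<beta> \<le>o \<gamma>" by (simp add: not_ordLess_iff_ordLeq)
  then consider "\<beta> <o \<gamma>" | "\<beta> =o \<gamma>" using ordLeq_iff_ordLess_or_ordIso by blast
  then show ?case
  proof cases
    case prems: 1
    from "1.IH"[OF \<gamma>\<alpha> \<gamma>(1) \<gamma>(2) prems \<open>Field \<beta> \<noteq> {}\<close>]
    obtain K where "right_submodule R (submod M N) K" "wu_class R \<beta> (submod M K)"
       "\<forall>\<gamma> :: 'o rel. wu_class R \<gamma> (submod M K) \<longrightarrow> \<beta> \<le>o \<gamma>" by auto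
    with right_submodule_trans[OF M(1) N(1)] show ?thesis by blast
  next
    case 2
    have "wu_class R \<beta> (submod M N)"
      using wu_class_ordIso[OF \<gamma>(1) ordIso_symmetric[OF 2]] .
    moreover have "\<beta> \<le>o \<delta>" if "wu_class R \<delta> (submod M N)" for \<delta> :: "'o rel"
      using ordIso_ordLeq_trans[OF 2 \<gamma>(2)[OF that]] .
    ultimately show ?thesis using N(1) by blast
  qed
qed

lemma has_wdim_if_is_wdim:
  fixes \<alpha> :: "'o rel"
  assumes "is_wdim R (M :: ('m, 'r, 'y) rmodule_scheme) \<alpha>"
  shows "has_wdim R M"
proof (cases "zero_module M")
  case True
  then show ?thesis by (auto simp: has_wdim_def is_wdim_def)
next
  case False
  with assms have \<alpha>: "wu_class R \<alpha> M" "\<And>\<gamma> :: 'o rel. wu_class R \<gamma> M \<Longrightarrow> \<alpha> \<le>o \<gamma>"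
    by (simp_all add: is_wdim_def)
  then have wo: "Well_order \<alpha>" using wu_classD(1) by blast
  define B where "B a = Restr \<alpha> (underS \<alpha> a)" for a
  have FB: "Field (B a) = underS \<alpha> a" for a
    unfolding B_def
    using wo by (simp add: Field_Restr_ofilter wo_rel.underS_ofilter wo_rel_def)
  have BB: "B a <o \<alpha>" if "a \<in> Field \<alpha>" for a
    unfolding B_def using that wo
    by (intro underS_Restr_ordLess) auto
  have B_mono: "B a <o B b" if "(a, b) \<in> \<alpha>" "a \<noteq> b" for a b
  proof -
    have a: "a \<in> underS \<alpha> b" using that by (simp add: underS_def)
    have sub: "underS \<alpha> a \<subset> underS \<alpha> b"
    proof -
      have "underS \<alpha> a \<subseteq> underS \<alpha> b"
        using that(1) wo by (intro underS_incr) (simp_all add: order_on_defs)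
      moreover have "a \<notin> underS \<alpha> a" by (simp add: underS_def)
      ultimately show ?thesis using a by blast
    qed
    then show ?thesis unfolding B_def
      using ofilter_subset_ordLess[OF wo, of "underS \<alpha> a" "underS \<alpha> b"] wo
      by (simp add: wo_rel_def wo_rel.underS_ofilter)
  qed
  define P where "P a N \<longleftrightarrow> (if B a = {} then N = {\<zero>\<^bsub>M\<^esub>} else wu_class R (B a) (submod M N) \<and>
           (\<forall>\<gamma> :: 'o rel. wu_class R \<gamma> (submod M N) \<longrightarrow> B a \<le>o \<gamma>))" for a N
  have "\<exists>N. P a N" if "a \<in> Field \<alpha>" for a
  proof (cases "B a = {}")
    case False
    then have "Field (B a) \<noteq> {}" by (auto simp: Field_def)
    with wu_class_hit[OF \<alpha> BB[OF that]] False show ?thesis by (auto simp: P_def)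
  qed (simp add: P_def)
  then obtain g where g: "\<And>a. a \<in> Field \<alpha> \<Longrightarrow> P a (g a)" by metis
  have neq: "g a \<noteq> g b" if "(a, b) \<in> \<alpha>" "a \<noteq> b" for a b
  proof
    assume eq: "g a = g b"
    have F: "a \<in> Field \<alpha>" "b \<in> Field \<alpha>" using that by (auto simp: Field_def)
    have "a \<in> Field (B b)" using that by (simp add: FB underS_def)
    then have "B b \<noteq> {}" by (auto simp: Field_def)
    with g[OF F(2)] have b: "wu_class R (B b) (submod M (g b))"
      "\<And>\<gamma> :: 'o rel. wu_class R \<gamma> (submod M (g b)) \<Longrightarrow> B b \<le>o \<gamma>" by (simp_all add: P_def)
    show False
    proof (cases "B a = {}")
      case True
      with g[OF F(1)] eq have "g b = {\<zero>\<^bsub>M\<^esub>}" by (simp add: P_def)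
      with wu_classD(4)[OF b(1)] show False by (simp add: zero_module_def)
    next
      case False
      with g[OF F(1)] eq have "wu_class R (B a) (submod M (g b))" by (simp add: P_def)
      with b(2) B_mono[OF that] show False using not_ordLess_ordLeq by blast
    qed
  qed
  have inj: "inj_on g (Field \<alpha>)"
  proof (rule inj_onI, rule ccontr)
    fix a b assume ab: "a \<in> Field \<alpha>" "b \<in> Field \<alpha>" "g a = g b" "a \<noteq> b"
    then have "(a, b) \<in> \<alpha> \<or> (b, a) \<in> \<alpha>"
      using wo by (auto simp: well_order_on_def linear_order_on_def total_on_def)
    with neq ab show False by metis
  qed
  have "wu_class R (dir_image \<alpha> g) M"
    using wu_class_ordIso[OF \<alpha>(1) dir_image_ordIso[OF wo inj]] .
  then obtain \<gamma> :: "'m set rel" where "wu_class R \<gamma> M"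
    "\<And>\<beta> :: 'm set rel. wu_class R \<beta> M \<Longrightarrow> \<gamma> \<le>o \<beta>"
    using wu_class_least by blast
  with False show ?thesis by (auto simp: has_wdim_def is_wdim_def)
qed

end

theory Submission
  imports Defs "HOL-Library.Ramsey"
begin

text \<open>
  Fix a decomposition of \<open>M\<close> into simple summands.  Every submodule is isomorphic to the span of a
  subset of the summands, so if only finitely many isomorphism types occur, a submodule \<open>N\<close> embeds
  into \<open>K\<close> as soon as each of the finitely many multiplicities of \<open>N\<close> is at most that of \<open>K\<close>.
  Hence non-embedding of a submodule into a smaller one is a transitive relation covered by finitely
  many well-founded ones (a strict drop of the \<open>i\<close>-th multiplicity, for some \<open>i\<close>), and therefore
  well-founded, which yields a dimension by transfinite recursion.  Conversely, if infinitely many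
  types occur, removing one of them gives a submodule that again has infinitely many types and into
  which the module does not embed, so no ordinal can be the dimension.
\<close>

section \<open>Submodules and homomorphisms\<close>

text \<open>The proof never compares two spanning sets of the same submodule. The multiplicities of
  a submodule are those of one chosen spanning set, and only one implication about them is
  established: multiplicities that are all at most those of K yield an embedding into K. So for K
  \<subseteq> N it is not known that no multiplicity rises on the way down, and the tuples of
  multiplicities cannot be ordered componentwise or lexicographically. What remains is that each
  non-embedding forces a drop at some index, and this index may change from pair to pair. Ramsey's
  theorem closes the gap: in an infinite descending chain of a transitive relation, some infinite
  subchain would have all its pairs dropping at one and the same index. A second obstacle is the
  first class, which is defined by weak uniseriality and not by the recursive clause. The
  construction of a dimension therefore stays above index one, while the converse treats index one
  separately.\<close>

lemma rmodule_homD: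
  assumes "f \<in> rmodule_hom R A B"
  shows "x \<in> carrier A \<Longrightarrow> f x \<in> carrier B"
    and "x \<in> carrier A \<Longrightarrow> y \<in> carrier A \<Longrightarrow> f (x \<oplus>\<^bsub>A\<^esub> y) = f x \<oplus>\<^bsub>B\<^esub> f y"
    and "x \<in> carrier A \<Longrightarrow> a \<in> carrier R \<Longrightarrow> f (x \<star>\<^bsub>A\<^esub> a) = f x \<star>\<^bsub>B\<^esub> a"
  using assms by (auto simp: rmodule_hom_def)

lemma rmodule_hom_comp:
  assumes "f \<in> rmodule_hom R A B" "g \<in> rmodule_hom R B C"
  shows "g \<circ> f \<in> rmodule_hom R A C"
  using assms by (auto simp: rmodule_hom_def Pi_iff)

lemma rmodule_hom_restrict_dom:
  assumes "f \<in> rmodule_hom R A B" "N \<subseteq> carrier A"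
  shows "f \<in> rmodule_hom R (submod A N) B"
  using assms by (auto simp: rmodule_hom_def Pi_iff subset_iff)

lemma rmodule_iso_trans:
  assumes "rmodule_iso R A B" "rmodule_iso R B C"
  shows "rmodule_iso R A C"
  using assms rmodule_hom_comp bij_betw_trans unfolding rmodule_iso_def by blast

lemma rmodule_iso_refl: "rmodule_iso R A A"
  unfolding rmodule_iso_def by (intro bexI[of _ "\<lambda>x. x"]) (auto simp: rmodule_hom_def bij_betw_def)

lemma rmodule_iso_imp_embeds: "rmodule_iso R A B \<Longrightarrow> embeds R A B"
  by (auto simp: rmodule_iso_def embeds_def bij_betw_def)

context right_module
begin

text \<open>Negatives come for free: \<ominus>x is x acted on by the negative of the ring's
  identity, so closure under the action gives closure under inverses.\<close>

lemma right_submoduleI: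
  assumes "N \<subseteq> carrier M" "\<zero>\<^bsub>M\<^esub> \<in> N" "\<And>x y. x \<in> N \<Longrightarrow> y \<in> N \<Longrightarrow> x \<oplus>\<^bsub>M\<^esub> y \<in> N"
    and "\<And>x a. x \<in> N \<Longrightarrow> a \<in> carrier R \<Longrightarrow> x \<star>\<^bsub>M\<^esub> a \<in> N"
  shows "right_submodule R M N"
proof -
  have neg: "\<ominus>\<^bsub>M\<^esub> x = x \<star>\<^bsub>M\<^esub> (\<ominus>\<^bsub>R\<^esub> \<one>\<^bsub>R\<^esub>)" if "x \<in> N" for x
  proof -
    have x: "x \<in> carrier M" using that assms(1) by blast
    have z: "x \<star>\<^bsub>M\<^esub> \<zero>\<^bsub>R\<^esub> = \<zero>\<^bsub>M\<^esub>"
      using ract_add_right[OF x R.zero_closed R.zero_closed] ract_closed[OF x R.zero_closed]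
      by (metis M.add.r_cancel_one R.l_zero R.zero_closed)
    have "x \<star>\<^bsub>M\<^esub> (\<ominus>\<^bsub>R\<^esub> \<one>\<^bsub>R\<^esub>) \<oplus>\<^bsub>M\<^esub> x = x \<star>\<^bsub>M\<^esub> (\<ominus>\<^bsub>R\<^esub> \<one>\<^bsub>R\<^esub> \<oplus>\<^bsub>R\<^esub> \<one>\<^bsub>R\<^esub>)"
      using x by (simp add: ract_add_right ract_one)
    then have "x \<star>\<^bsub>M\<^esub> (\<ominus>\<^bsub>R\<^esub> \<one>\<^bsub>R\<^esub>) \<oplus>\<^bsub>M\<^esub> x = \<zero>\<^bsub>M\<^esub>"
      by (simp add: R.l_neg z)
    then show ?thesis using x by (intro M.minus_equality) (auto intro: ract_closed)
  qed
  have "subgroup N (add_monoid M)"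
  proof (rule group.subgroupI[OF M.a_group])
    fix x assume "x \<in> N"
    then show "inv\<^bsub>add_monoid M\<^esub> x \<in> N"
      using neg[of x] assms(4)[of x] by (simp add: a_inv_def[symmetric])
  qed (use assms in auto)
  with assms(4) show ?thesis by (simp add: right_submodule_def)
qed

lemma right_submoduleD:
  assumes "right_submodule R M N"
  shows "x \<in> N \<Longrightarrow> x \<in> carrier M" "\<zero>\<^bsub>M\<^esub> \<in> N" "x \<in> N \<Longrightarrow> y \<in> N \<Longrightarrow> x \<oplus>\<^bsub>M\<^esub> y \<in> N"
    "x \<in> N \<Longrightarrow> a \<in> carrier R \<Longrightarrow> x \<star>\<^bsub>M\<^esub> a \<in> N" "x \<in> N \<Longrightarrow> \<ominus>\<^bsub>M\<^esub> x \<in> N"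
proof -
  have s: "subgroup N (add_monoid M)" using assms by (simp add: right_submodule_def)
  show "x \<in> N \<Longrightarrow> x \<in> carrier M" using right_submodule_subset[OF assms] by blast
  show "\<zero>\<^bsub>M\<^esub> \<in> N" using subgroup.one_closed[OF s] by simp
  show "x \<in> N \<Longrightarrow> y \<in> N \<Longrightarrow> x \<oplus>\<^bsub>M\<^esub> y \<in> N" using subgroup.m_closed[OF s] by simp
  show "x \<in> N \<Longrightarrow> a \<in> carrier R \<Longrightarrow> x \<star>\<^bsub>M\<^esub> a \<in> N" using assms by (simp add: right_submodule_def)
  show "x \<in> N \<Longrightarrow> \<ominus>\<^bsub>M\<^esub> x \<in> N" using subgroup.m_inv_closed[OF s] by (simp add: a_inv_def)
qed

lemma right_module_submod:
  assumes "right_submodule R M N"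
  shows "right_module R (submod M N)"
proof -
  note N = right_submoduleD[OF assms]
  have "abelian_group (submod M N)"
  proof (rule abelian_groupI)
    fix x assume "x \<in> carrier (submod M N)"
    with N show "\<exists>y\<in>carrier (submod M N). y \<oplus>\<^bsub>submod M N\<^esub> x = \<zero>\<^bsub>submod M N\<^esub>"
      by (intro bexI[of _ "\<ominus>\<^bsub>M\<^esub> x"]) (auto simp: M.l_neg)
  qed (use N in \<open>auto simp: M.a_assoc intro: M.a_comm\<close>)
  then show ?thesis
    using N by (intro right_module.intro right_module_axioms.intro R.ring_axioms)
      (auto simp: ract_add_left ract_add_right ract_assoc ract_one)
qed

lemma right_submodule_submod_iff:
  assumes "right_submodule R M N"
  shows "right_submodule R (submod M N) K \<longleftrightarrow> right_submodule R M K \<and> K \<subseteq> N"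
proof (intro iffI conjI)
  assume K: "right_submodule R (submod M N) K"
  show "right_submodule R M K" using right_submodule_trans[OF right_module_axioms assms K] .
  show "K \<subseteq> N" using right_submodule_subset[OF K] by simp
next
  assume K: "right_submodule R M K \<and> K \<subseteq> N"
  then show "right_submodule R (submod M N) K"
    using right_submoduleD[of K]
    by (intro right_module.right_submoduleI[OF right_module_submod[OF assms]]) auto
qed

lemma simple_submod_iff:
  assumes "right_submodule R M S"
  shows "simple_rmodule R (submod M S) \<longleftrightarrow>
    S \<noteq> {\<zero>\<^bsub>M\<^esub>} \<and> (\<forall>K. right_submodule R M K \<longrightarrow> K \<subseteq> S \<longrightarrow> K = {\<zero>\<^bsub>M\<^esub>} \<or> K = S)"
  using right_module_submod[OF assms]
  by (auto simp: simple_rmodule_def zero_module_def right_submodule_submod_iff[OF assms])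

lemma right_submodule_Int:
  assumes "right_submodule R M N" "right_submodule R M K"
  shows "right_submodule R M (N \<inter> K)"
  using right_submoduleD[OF assms(1)] right_submoduleD[OF assms(2)] by (intro right_submoduleI) auto

lemma right_submodule_carrier: "right_submodule R M (carrier M)"
  by (intro right_submoduleI) (auto intro: ract_closed)

lemma right_submodule_zero: "right_submodule R M {\<zero>\<^bsub>M\<^esub>}"
proof -
  have "\<zero>\<^bsub>M\<^esub> \<star>\<^bsub>M\<^esub> a = \<zero>\<^bsub>M\<^esub>" if "a \<in> carrier R" for a
    using ract_add_left[of "\<zero>\<^bsub>M\<^esub>" "\<zero>\<^bsub>M\<^esub>" a] ract_closed[of "\<zero>\<^bsub>M\<^esub>" a] that
    by (metis M.add.r_cancel_one M.l_zero M.zero_closed)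
  then show ?thesis by (intro right_submoduleI) auto
qed

lemma zero_ract: "a \<in> carrier R \<Longrightarrow> \<zero>\<^bsub>M\<^esub> \<star>\<^bsub>M\<^esub> a = \<zero>\<^bsub>M\<^esub>"
  using right_submoduleD(4)[OF right_submodule_zero] by simp

lemma finsum_ract:
  assumes "finite F" "\<And>i. i \<in> F \<Longrightarrow> f i \<in> carrier M" "a \<in> carrier R"
  shows "finsum M f F \<star>\<^bsub>M\<^esub> a = finsum M (\<lambda>i. f i \<star>\<^bsub>M\<^esub> a) F"
  using assms
proof (induction F)
  case empty
  then show ?case by (simp add: zero_ract)
next
  case (insert i F)
  then have *: "f \<in> F \<rightarrow> carrier M" "(\<lambda>i. f i \<star>\<^bsub>M\<^esub> a) \<in> F \<rightarrow> carrier M"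
    by (auto intro: ract_closed)
  have "finsum M f (insert i F) \<star>\<^bsub>M\<^esub> a = (f i \<oplus>\<^bsub>M\<^esub> finsum M f F) \<star>\<^bsub>M\<^esub> a"
    using insert * by (subst M.finsum_insert) auto
  also have "\<dots> = f i \<star>\<^bsub>M\<^esub> a \<oplus>\<^bsub>M\<^esub> finsum M (\<lambda>i. f i \<star>\<^bsub>M\<^esub> a) F"
    using insert * by (subst ract_add_left) auto
  also have "\<dots> = finsum M (\<lambda>i. f i \<star>\<^bsub>M\<^esub> a) (insert i F)"
    using insert * by (subst M.finsum_insert) (auto intro: ract_closed)
  finally show ?case .
qed

text \<open>\<open>finsum\<close> consults the carrier of its structure, so changing the carrier is
  not harmless by definition; both sums are unfolded one summand at a time instead.\<close>

lemma finsum_submod: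
  assumes N: "right_submodule R M N" and "finite F" "\<And>i. i \<in> F \<Longrightarrow> f i \<in> N"
  shows "finsum (submod M N) f F = finsum M f F"
proof -
  interpret N: right_module R "submod M N" using right_module_submod[OF N] .
  show ?thesis
    using assms(2,3)
  proof (induction F)
    case empty
    show ?case using M.finsum_empty N.M.finsum_empty by simp
  next
    case (insert i F)
    then have "f \<in> F \<rightarrow> carrier (submod M N)" "f \<in> F \<rightarrow> carrier M"
      using right_submoduleD(1)[OF N] by auto
    with insert show ?case
      using right_submoduleD(1)[OF N] by (simp add: M.finsum_insert N.M.finsum_insert)
  qed
qed

end

section \<open>Homomorphisms, kernels, images and Schur's lemma\<close>

locale rmodule_homomorphism =
  A: right_module R A + B: right_module R B
  for R :: "('r, 'x) ring_scheme" and A :: "('m, 'r, 'y) rmodule_scheme"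
    and B :: "('n, 'r, 'z) rmodule_scheme" +
  fixes f
  assumes hom: "f \<in> rmodule_hom R A B"
begin

lemmas fun_simps = rmodule_homD[OF hom]

lemma f_zero: "f \<zero>\<^bsub>A\<^esub> = \<zero>\<^bsub>B\<^esub>"
  using fun_simps(2)[of "\<zero>\<^bsub>A\<^esub>" "\<zero>\<^bsub>A\<^esub>"] fun_simps(1)[of "\<zero>\<^bsub>A\<^esub>"] by simp

lemma f_neg:
  assumes "x \<in> carrier A"
  shows "f (\<ominus>\<^bsub>A\<^esub> x) = \<ominus>\<^bsub>B\<^esub> f x"
proof -
  have "f (\<ominus>\<^bsub>A\<^esub> x) \<oplus>\<^bsub>B\<^esub> f x = \<zero>\<^bsub>B\<^esub>"
    using assms fun_simps(2)[of "\<ominus>\<^bsub>A\<^esub> x" x] by (simp add: A.M.l_neg f_zero)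
  then show ?thesis using assms fun_simps(1) by (intro B.M.minus_equality[symmetric]) auto
qed

lemma inj_iff: "inj_on f (carrier A) \<longleftrightarrow> (\<forall>x\<in>carrier A. f x = \<zero>\<^bsub>B\<^esub> \<longrightarrow> x = \<zero>\<^bsub>A\<^esub>)"
proof
  assume inj: "inj_on f (carrier A)"
  then show "\<forall>x\<in>carrier A. f x = \<zero>\<^bsub>B\<^esub> \<longrightarrow> x = \<zero>\<^bsub>A\<^esub>"
    using f_zero inj_onD[OF inj, of _ "\<zero>\<^bsub>A\<^esub>"] by auto
next
  assume ker: "\<forall>x\<in>carrier A. f x = \<zero>\<^bsub>B\<^esub> \<longrightarrow> x = \<zero>\<^bsub>A\<^esub>"
  show "inj_on f (carrier A)"
  proof (rule inj_onI)
    fix x y assume xy: "x \<in> carrier A" "y \<in> carrier A" "f x = f y"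
    then have "f (x \<oplus>\<^bsub>A\<^esub> \<ominus>\<^bsub>A\<^esub> y) = \<zero>\<^bsub>B\<^esub>"
      using fun_simps(1) by (simp add: fun_simps(2) f_neg B.M.r_neg)
    with ker xy have "x \<oplus>\<^bsub>A\<^esub> \<ominus>\<^bsub>A\<^esub> y = \<zero>\<^bsub>A\<^esub>" by simp
    with xy show "x = y" by (metis A.M.a_inv_closed A.M.minus_equality A.M.minus_minus)
  qed
qed

lemma image_submodule:
  assumes "right_submodule R A N"
  shows "right_submodule R B (f ` N)"
proof (rule B.right_submoduleI)
  note N = A.right_submoduleD[OF assms]
  show "f ` N \<subseteq> carrier B" using N(1) fun_simps(1) by blast
  show "\<zero>\<^bsub>B\<^esub> \<in> f ` N" using N(2) f_zero by force
  show "x \<oplus>\<^bsub>B\<^esub> y \<in> f ` N" if "x \<in> f ` N" "y \<in> f ` N" for x y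
    using that N(1,3) by (auto simp: fun_simps(2)[symmetric])
  show "x \<star>\<^bsub>B\<^esub> a \<in> f ` N" if "x \<in> f ` N" "a \<in> carrier R" for x a
    using that N(1,4) by (auto simp: fun_simps(3)[symmetric])
qed

lemma kernel_submodule: "right_submodule R A {x \<in> carrier A. f x = \<zero>\<^bsub>B\<^esub>}"
  by (rule A.right_submoduleI) (auto simp: f_zero fun_simps A.ract_closed B.zero_ract)

text \<open>Schur's lemma: the kernel is not everything and the image is not zero, so simplicity of
  both sides leaves a zero kernel and a full image.\<close>

lemma simple_iso:
  assumes "simple_rmodule R A" "simple_rmodule R B" "x \<in> carrier A" "f x \<noteq> \<zero>\<^bsub>B\<^esub>"
  shows "rmodule_iso R A B"
proof -
  have "{x \<in> carrier A. f x = \<zero>\<^bsub>B\<^esub>} = {\<zero>\<^bsub>A\<^esub>}"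
    using kernel_submodule assms(1,3,4) unfolding simple_rmodule_def by blast
  then have "inj_on f (carrier A)" unfolding inj_iff by blast
  moreover have "f ` carrier A = carrier B"
    using image_submodule[OF A.right_submodule_carrier] assms(2-4) unfolding simple_rmodule_def by blast
  ultimately show ?thesis using hom by (auto simp: rmodule_iso_def bij_betw_def)
qed

end

lemma rmodule_iso_sym:
  assumes "right_module R A" "rmodule_iso R A B"
  shows "rmodule_iso R B A"
proof -
  interpret right_module R A by fact
  obtain f where f: "f \<in> rmodule_hom R A B" "bij_betw f (carrier A) (carrier B)"
    using assms(2) by (auto simp: rmodule_iso_def)
  let ?g = "inv_into (carrier A) f"
  have g: "?g (f x) = x" if "x \<in> carrier A" for x
    using f(2) that by (simp add: bij_betw_inv_into_left)
  have B: "carrier B = f ` carrier A" using f(2) by (simp add: bij_betw_def)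
  have "?g \<in> rmodule_hom R B A"
    unfolding rmodule_hom_def B
    by (auto simp: g ract_closed rmodule_homD(2,3)[OF f(1), symmetric])
  with bij_betw_inv_into[OF f(2)] show ?thesis by (auto simp: rmodule_iso_def)
qed

section \<open>Components of a direct sum\<close>

locale direct_decomposition = right_module R M
  for R :: "('r, 'x) ring_scheme" (structure) and M :: "('m, 'r, 'y) rmodule_scheme" (structure) +
  fixes I :: "'i set" and S :: "'i \<Rightarrow> 'm set"
  assumes decomp: "internal_direct_sum R M I S"
begin

definition component :: "'m \<Rightarrow> 'i \<Rightarrow> 'm" where
  "component x = (THE f. f \<in> (\<Pi>\<^sub>E i\<in>I. S i) \<and> finite {i\<in>I. f i \<noteq> \<zero>\<^bsub>M\<^esub>} \<and>
     x = finsum M f {i\<in>I. f i \<noteq> \<zero>\<^bsub>M\<^esub>})"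

lemma summand_submodule: "i \<in> I \<Longrightarrow> right_submodule R M (S i)"
  using decomp by (simp add: internal_direct_sum_def)

lemmas summandD = right_submoduleD[OF summand_submodule]

lemma component_ex1:
  assumes "x \<in> carrier M"
  shows "\<exists>!f. f \<in> (\<Pi>\<^sub>E i\<in>I. S i) \<and> finite {i\<in>I. f i \<noteq> \<zero>\<^bsub>M\<^esub>} \<and>
     x = finsum M f {i\<in>I. f i \<noteq> \<zero>\<^bsub>M\<^esub>}"
  using decomp assms by (simp add: internal_direct_sum_def)

lemma component_PiE: "x \<in> carrier M \<Longrightarrow> component x \<in> (\<Pi>\<^sub>E i\<in>I. S i)"
  and finite_component: "x \<in> carrier M \<Longrightarrow> finite {i\<in>I. component x i \<noteq> \<zero>\<^bsub>M\<^esub>}"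
  and finsum_component: "x \<in> carrier M \<Longrightarrow> x = finsum M (component x) {i\<in>I. component x i \<noteq> \<zero>\<^bsub>M\<^esub>}"
  using theI'[OF component_ex1, of x] unfolding component_def[symmetric] by blast+

lemma component_mem: "x \<in> carrier M \<Longrightarrow> i \<in> I \<Longrightarrow> component x i \<in> S i"
  using component_PiE by blast

lemma component_closed: "x \<in> carrier M \<Longrightarrow> i \<in> I \<Longrightarrow> component x i \<in> carrier M"
  using component_mem summandD(1) by blast

text \<open>This is how uniqueness of the decomposition is used throughout. F may be larger than the
  support of f, so that several families can be summed over one common index set.\<close>

lemma component_finsum:
  assumes f: "\<And>i. i \<in> I \<Longrightarrow> f i \<in> S i" and F: "finite F" "F \<subseteq> I" "\<And>i. i \<in> I - F \<Longrightarrow> f i = \<zero>\<^bsub>M\<^esub>"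
    and i: "i \<in> I"
  shows "component (finsum M f F) i = f i"
proof -
  let ?g = "restrict f I"
  have c: "f j \<in> carrier M" if "j \<in> I" for j using f[OF that] summandD(1)[OF that] by blast
  have supp: "{i\<in>I. ?g i \<noteq> \<zero>\<^bsub>M\<^esub>} \<subseteq> F" using F(3) by auto
  have "finsum M ?g {i\<in>I. ?g i \<noteq> \<zero>\<^bsub>M\<^esub>} = finsum M f F"
  proof (rule M.add.finprod_mono_neutral_cong_left[OF F(1) supp])
    show "f i = \<zero>\<^bsub>M\<^esub>" if "i \<in> F - {i\<in>I. ?g i \<noteq> \<zero>\<^bsub>M\<^esub>}" for i
      using that F(2) by auto
    show "f \<in> F \<rightarrow> carrier M" using c F(2) by blast
  qed simp
  moreover have "finite {i\<in>I. ?g i \<noteq> \<zero>\<^bsub>M\<^esub>}" using supp F(1) finite_subset by blast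
  moreover have "?g \<in> (\<Pi>\<^sub>E i\<in>I. S i)" using f by auto
  moreover have x: "finsum M f F \<in> carrier M" using c F(2) by (intro M.finsum_closed) auto
  ultimately have "component (finsum M f F) = ?g"
    unfolding component_def by (intro the1_equality[OF component_ex1[OF x]]) auto
  then show ?thesis using i by simp
qed

lemma ex_with_components:
  assumes "\<And>i. i \<in> I \<Longrightarrow> f i \<in> S i" "finite {i\<in>I. f i \<noteq> \<zero>\<^bsub>M\<^esub>}"
  shows "\<exists>x\<in>carrier M. \<forall>i\<in>I. component x i = f i"
proof (intro bexI ballI)
  show "component (finsum M f {i\<in>I. f i \<noteq> \<zero>\<^bsub>M\<^esub>}) i = f i" if "i \<in> I" for i
    using assms that by (intro component_finsum) auto
  show "finsum M f {i\<in>I. f i \<noteq> \<zero>\<^bsub>M\<^esub>} \<in> carrier M"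
    using assms summandD(1) by (intro M.finsum_closed) auto
qed

lemma component_eqI:
  assumes x: "x \<in> carrier M" and y: "y \<in> carrier M"
    and eq: "\<And>i. i \<in> I \<Longrightarrow> component x i = component y i"
  shows "x = y"
proof -
  have "component x = component y"
    using component_PiE[OF x] component_PiE[OF y] eq by (rule PiE_ext)
  then show ?thesis using finsum_component[OF x] finsum_component[OF y] by simp
qed

lemma component_add:
  assumes x: "x \<in> carrier M" and y: "y \<in> carrier M" and i: "i \<in> I"
  shows "component (x \<oplus>\<^bsub>M\<^esub> y) i = component x i \<oplus>\<^bsub>M\<^esub> component y i"
proof -
  \<comment> \<open>The supports of x, y and their sum may all differ; the union of the first two
    serves for all three.\<close>
  let ?F = "{i\<in>I. component x i \<noteq> \<zero>\<^bsub>M\<^esub>} \<union> {i\<in>I. component y i \<noteq> \<zero>\<^bsub>M\<^esub>}"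
  have F: "finite ?F" using finite_component x y by simp
  have fs: "finsum M (component z) ?F = z"
    if z: "z \<in> carrier M" and sub: "{i\<in>I. component z i \<noteq> \<zero>\<^bsub>M\<^esub>} \<subseteq> ?F" for z
  proof -
    have "finsum M (component z) ?F = finsum M (component z) {i\<in>I. component z i \<noteq> \<zero>\<^bsub>M\<^esub>}"
      using F sub component_closed[OF z] by (intro M.add.finprod_mono_neutral_cong_right) auto
    with finsum_component[OF z] show ?thesis by simp
  qed
  have "finsum M (\<lambda>i. component x i \<oplus>\<^bsub>M\<^esub> component y i) ?F
      = finsum M (component x) ?F \<oplus>\<^bsub>M\<^esub> finsum M (component y) ?F"
    using component_closed x y by (intro M.finsum_addf) auto
  also have "\<dots> = x \<oplus>\<^bsub>M\<^esub> y" using x y by (simp add: fs)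
  finally have "component (x \<oplus>\<^bsub>M\<^esub> y) i
      = component (finsum M (\<lambda>i. component x i \<oplus>\<^bsub>M\<^esub> component y i) ?F) i" by simp
  also have "\<dots> = component x i \<oplus>\<^bsub>M\<^esub> component y i"
    using component_mem[OF x] component_mem[OF y] summandD(3) F i by (intro component_finsum) auto
  finally show ?thesis .
qed

lemma component_ract:
  assumes x: "x \<in> carrier M" and a: "a \<in> carrier R" and i: "i \<in> I"
  shows "component (x \<star>\<^bsub>M\<^esub> a) i = component x i \<star>\<^bsub>M\<^esub> a"
proof -
  let ?F = "{i\<in>I. component x i \<noteq> \<zero>\<^bsub>M\<^esub>}"
  have "finsum M (component x) ?F \<star>\<^bsub>M\<^esub> a = finsum M (\<lambda>i. component x i \<star>\<^bsub>M\<^esub> a) ?F"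
    using finite_component[OF x] component_closed[OF x] a by (intro finsum_ract) auto
  then have "x \<star>\<^bsub>M\<^esub> a = finsum M (\<lambda>i. component x i \<star>\<^bsub>M\<^esub> a) ?F"
    using finsum_component[OF x] by simp
  also have "component \<dots> i = component x i \<star>\<^bsub>M\<^esub> a"
    using component_mem[OF x] summandD(4) finite_component[OF x] i a zero_ract
    by (intro component_finsum) auto
  finally show ?thesis .
qed

lemma component_hom:
  assumes "i \<in> I"
  shows "(\<lambda>x. component x i) \<in> rmodule_hom R M (submod M (S i))"
  using assms by (auto simp: rmodule_hom_def component_mem component_add component_ract)

lemma component_summand:
  assumes "i \<in> I" "x \<in> S i" "j \<in> I"
  shows "component x j = (if j = i then x else \<zero>\<^bsub>M\<^esub>)"
proof -
  let ?f = "\<lambda>j. if j = i then x else \<zero>\<^bsub>M\<^esub>"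
  have x: "x \<in> carrier M" using assms summandD(1) by blast
  have "finsum M ?f {i} = x" using x by (subst M.finsum_insert) auto
  moreover have "component (finsum M ?f {i}) j = ?f j"
    using assms summandD(2) by (intro component_finsum) auto
  ultimately show ?thesis by simp
qed

lemma component_zero: "i \<in> I \<Longrightarrow> component \<zero>\<^bsub>M\<^esub> i = \<zero>\<^bsub>M\<^esub>"
  using component_summand[OF _ summandD(2)] by simp

lemma component_of_finsum:
  assumes "finite F" "\<And>k. k \<in> F \<Longrightarrow> f k \<in> carrier M" "i \<in> I"
  shows "component (finsum M f F) i = finsum M (\<lambda>k. component (f k) i) F"
  using assms
proof (induction F)
  case empty
  then show ?case by (simp add: component_zero)
next
  case (insert k F)
  then have *: "f \<in> F \<rightarrow> carrier M" "(\<lambda>k. component (f k) i) \<in> F \<rightarrow> carrier M"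
    by (auto intro: component_closed)
  then show ?case using insert
    by (simp add: M.finsum_insert component_add component_closed)
qed

section \<open>Spans of subfamilies of the summands\<close>

text \<open>This is the span of the summands indexed by B, as \<open>summand_le_support\<close> and
  \<open>support_module_least\<close> confirm. Describing it by vanishing components makes
  membership a pointwise condition, and B may contain indices outside I.\<close>

definition support_module :: "'i set \<Rightarrow> 'm set" where
  "support_module B = {x \<in> carrier M. \<forall>i\<in>I - B. component x i = \<zero>\<^bsub>M\<^esub>}"

lemma support_submodule: "right_submodule R M (support_module B)"
  by (rule right_submoduleI)
    (auto simp: support_module_def component_zero component_add component_ract ract_closed zero_ract)

lemma support_module_mono: "B \<subseteq> C \<Longrightarrow> support_module B \<subseteq> support_module C"
  by (auto simp: support_module_def)

lemma support_module_I: "support_module I = carrier M"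
  by (auto simp: support_module_def)

lemma summand_le_support:
  assumes "i \<in> B" "i \<in> I"
  shows "S i \<subseteq> support_module B"
  using assms summandD(1)[OF assms(2)] component_summand[OF assms(2)]
  by (auto simp: support_module_def)

lemma support_module_least:
  assumes N: "right_submodule R M N" and B: "\<And>i. i \<in> I \<inter> B \<Longrightarrow> S i \<subseteq> N"
  shows "support_module B \<subseteq> N"
proof
  fix x assume "x \<in> support_module B"
  then have x: "x \<in> carrier M" and z: "\<And>i. i \<in> I - B \<Longrightarrow> component x i = \<zero>\<^bsub>M\<^esub>"
    by (auto simp: support_module_def)
  let ?F = "{i\<in>I. component x i \<noteq> \<zero>\<^bsub>M\<^esub>}"
  have "component x i \<in> N" if "i \<in> ?F" for i
    using that z[of i] B[of i] component_mem[OF x, of i] by blast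
  with finite_component[OF x] have "finsum M (component x) ?F \<in> N"
  proof (induction rule: finite_induct)
    case empty
    then show ?case using right_submoduleD(2)[OF N] by simp
  next
    case (insert i F)
    then show ?case using right_submoduleD(1,3)[OF N]
      by (subst M.finsum_insert) auto
  qed
  with finsum_component[OF x] show "x \<in> N" by simp
qed

lemma ex_projection:
  obtains p where "p \<in> rmodule_hom R M (submod M (support_module B))"
    and "\<And>x i. x \<in> carrier M \<Longrightarrow> i \<in> I \<Longrightarrow>
      component (p x) i = (if i \<in> B then component x i else \<zero>\<^bsub>M\<^esub>)"
proof -
  have "\<exists>y\<in>carrier M. \<forall>i\<in>I. component y i = (if i \<in> B then component x i else \<zero>\<^bsub>M\<^esub>)"
    if x: "x \<in> carrier M" for x
    using component_mem[OF x] summandD(2)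
    by (intro ex_with_components) (auto intro: finite_subset[OF _ finite_component[OF x]])
  then obtain p where p: "\<And>x. x \<in> carrier M \<Longrightarrow> p x \<in> carrier M"
    "\<And>x i. x \<in> carrier M \<Longrightarrow> i \<in> I \<Longrightarrow> component (p x) i = (if i \<in> B then component x i else \<zero>\<^bsub>M\<^esub>)"
    by metis
  have "p \<in> rmodule_hom R M (submod M (support_module B))"
    unfolding rmodule_hom_def
  proof (safe; simp)
    fix x assume "x \<in> carrier M"
    then show "p x \<in> support_module B" by (simp add: support_module_def p)
  next
    fix x y assume "x \<in> carrier M" "y \<in> carrier M"
    then show "p (x \<oplus>\<^bsub>M\<^esub> y) = p x \<oplus>\<^bsub>M\<^esub> p y"
      by - (rule component_eqI, simp_all add: p component_add)
  next
    fix x a assume "x \<in> carrier M" "a \<in> carrier R"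
    then show "p (x \<star>\<^bsub>M\<^esub> a) = p x \<star>\<^bsub>M\<^esub> a"
      by - (rule component_eqI, simp_all add: p component_ract ract_closed zero_ract)
  qed
  with p(2) that show thesis by blast
qed

text \<open>The i-th component is moved into slot g i by an embedding of the single summands.
  Injectivity of g keeps different components in different slots, and injectivity of each h i makes
  the kernel trivial on the span of B.\<close>

lemma support_module_embeds:
  assumes "B \<subseteq> I" "C \<subseteq> I" "inj_on g B" "g ` B \<subseteq> C"
    and iso: "\<And>i. i \<in> B \<Longrightarrow> embeds R (submod M (S i)) (submod M (S (g i)))"
  shows "embeds R (submod M (support_module B)) (submod M (support_module C))"
proof -
  have "\<forall>i\<in>B. \<exists>h. h \<in> rmodule_hom R (submod M (S i)) (submod M (S (g i))) \<and> inj_on h (S i)"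
    using iso by (auto simp: embeds_def)
  then obtain h where h: "\<And>i. i \<in> B \<Longrightarrow> h i \<in> rmodule_hom R (submod M (S i)) (submod M (S (g i)))"
    "\<And>i. i \<in> B \<Longrightarrow> inj_on (h i) (S i)" by metis
  have gI: "g i \<in> I" if "i \<in> B" for i using that assms by blast
  have hhom: "rmodule_homomorphism R (submod M (S i)) (submod M (S (g i))) (h i)" if "i \<in> B" for i
    using that h(1) gI assms(1) right_module_submod[OF summand_submodule]
    by (auto simp: rmodule_homomorphism_def rmodule_homomorphism_axioms_def)
  note hs = rmodule_homD[OF h(1), simplified]
  have h0: "h i \<zero>\<^bsub>M\<^esub> = \<zero>\<^bsub>M\<^esub>" if "i \<in> B" for i
    using rmodule_homomorphism.f_zero[OF hhom[OF that]] by simp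
  have hinj: "y = \<zero>\<^bsub>M\<^esub>" if "i \<in> B" "y \<in> S i" "h i y = \<zero>\<^bsub>M\<^esub>" for i y
    using rmodule_homomorphism.inj_iff[OF hhom[OF that(1)]] h(2) that by auto
  have inv: "inv_into B g (g i) = i" if "i \<in> B" for i
    using that assms(3) by simp
  \<comment> \<open>The prescribed components of the image of x: slot j receives the component of
    its unique preimage under g, and zero if there is none.\<close>
  define q where "q x j = (if j \<in> g ` B then h (inv_into B g j) (component x (inv_into B g j)) else \<zero>\<^bsub>M\<^esub>)"
    for x j
  have q_g: "q x (g i) = h i (component x i)" if "i \<in> B" for x i
    using that by (simp add: q_def inv)
  have q_out: "q x j = \<zero>\<^bsub>M\<^esub>" if "j \<notin> g ` B" for x j
    using that by (simp add: q_def)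
  have "\<exists>y\<in>carrier M. \<forall>j\<in>I. component y j = q x j" if x: "x \<in> carrier M" for x
  proof (rule ex_with_components)
    fix j assume j: "j \<in> I"
    show "q x j \<in> S j"
    proof (cases "j \<in> g ` B")
      case True
      then obtain i where "i \<in> B" "j = g i" by blast
      then show ?thesis using hs(1) component_mem[OF x] assms(1) by (auto simp: q_g)
    qed (use summandD(2)[OF j] in \<open>simp add: q_out\<close>)
  next
    \<comment> \<open>Each h i maps zero to zero, so no new nonzero slots arise and the support
      stays finite.\<close>
    have "{j \<in> I. q x j \<noteq> \<zero>\<^bsub>M\<^esub>} \<subseteq> g ` {i\<in>I. component x i \<noteq> \<zero>\<^bsub>M\<^esub>}"
    proof
      fix j assume j: "j \<in> {j \<in> I. q x j \<noteq> \<zero>\<^bsub>M\<^esub>}"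
      then obtain i where i: "i \<in> B" "j = g i" using q_out by blast
      with j h0 have "component x i \<noteq> \<zero>\<^bsub>M\<^esub>" by (auto simp: q_g)
      with i assms(1) show "j \<in> g ` {i\<in>I. component x i \<noteq> \<zero>\<^bsub>M\<^esub>}" by auto
    qed
    then show "finite {j \<in> I. q x j \<noteq> \<zero>\<^bsub>M\<^esub>}"
      using finite_component[OF x] finite_surj by blast
  qed
  then obtain p where p: "\<And>x. x \<in> carrier M \<Longrightarrow> p x \<in> carrier M"
    "\<And>x j. x \<in> carrier M \<Longrightarrow> j \<in> I \<Longrightarrow> component (p x) j = q x j" by metis
  let ?A = "support_module B" and ?C = "support_module C"
  have car: "x \<in> carrier M" if "x \<in> ?A" for x using that by (simp add: support_module_def)
  have q_add: "q (x \<oplus>\<^bsub>M\<^esub> y) j = q x j \<oplus>\<^bsub>M\<^esub> q y j" if "x \<in> carrier M" "y \<in> carrier M" for x y j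
  proof (cases "j \<in> g ` B")
    case True
    then obtain i where i: "i \<in> B" "j = g i" by blast
    then have "i \<in> I" using assms(1) by blast
    with i that show ?thesis by (simp add: q_g component_add hs(2) component_mem)
  qed (simp add: q_out)
  have q_ract: "q (x \<star>\<^bsub>M\<^esub> a) j = q x j \<star>\<^bsub>M\<^esub> a" if "x \<in> carrier M" "a \<in> carrier R" for x a j
  proof (cases "j \<in> g ` B")
    case True
    then obtain i where i: "i \<in> B" "j = g i" by blast
    then have "i \<in> I" using assms(1) by blast
    with i that show ?thesis by (simp add: q_g component_ract hs(3) component_mem)
  qed (use that in \<open>simp add: q_out zero_ract\<close>)
  have p_hom: "p \<in> rmodule_hom R (submod M ?A) (submod M ?C)"
    unfolding rmodule_hom_def
  proof (safe; simp)
    fix x assume "x \<in> ?A"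
    moreover have "q x j = \<zero>\<^bsub>M\<^esub>" if "j \<in> I - C" for j
      using that assms(4) by (intro q_out) blast
    ultimately show "p x \<in> ?C" by (simp add: support_module_def p)
  next
    fix x y assume "x \<in> ?A" "y \<in> ?A"
    then show "p (x \<oplus>\<^bsub>M\<^esub> y) = p x \<oplus>\<^bsub>M\<^esub> p y"
      using car by - (rule component_eqI, simp_all add: p component_add q_add)
  next
    fix x a assume "x \<in> ?A" "a \<in> carrier R"
    then show "p (x \<star>\<^bsub>M\<^esub> a) = p x \<star>\<^bsub>M\<^esub> a"
      using car by - (rule component_eqI, simp_all add: p component_ract q_ract ract_closed)
  qed
  interpret p: rmodule_homomorphism R "submod M ?A" "submod M ?C" p
    using right_module_submod[OF support_submodule] p_hom
    by (simp add: rmodule_homomorphism_def rmodule_homomorphism_axioms_def)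
  have "x = \<zero>\<^bsub>M\<^esub>" if x: "x \<in> ?A" "p x = \<zero>\<^bsub>M\<^esub>" for x
  proof (rule component_eqI)
    fix i assume i: "i \<in> I"
    have "component x i = \<zero>\<^bsub>M\<^esub>"
    proof (cases "i \<in> B")
      case True
      then have "h i (component x i) = component (p x) (g i)"
        using car[OF x(1)] gI by (simp add: p q_g)
      then show ?thesis
        using hinj[OF True] component_mem[OF car[OF x(1)] i] x(2) gI[OF True] by (simp add: component_zero)
    qed (use x i in \<open>simp add: support_module_def\<close>)
    then show "component x i = component \<zero>\<^bsub>M\<^esub> i" using i by (simp add: component_zero)
  qed (use car x in auto)
  then have "inj_on p ?A" using p.inj_iff by simp
  with p_hom show ?thesis by (auto simp: embeds_def)
qed

lemma ex_nonzero_component: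
  assumes "x \<in> carrier M" "x \<noteq> \<zero>\<^bsub>M\<^esub>"
  obtains i where "i \<in> I" "component x i \<noteq> \<zero>\<^bsub>M\<^esub>"
  using component_eqI[OF assms(1) M.zero_closed] assms(2) component_zero by metis

text \<open>The nonzero value f x has a nonzero component, and its index lies in B. Following f by
  that component gives a nonzero map between simple modules, to which Schur's lemma applies.\<close>

lemma simple_iso_summand:
  assumes simple: "\<And>i. i \<in> I \<Longrightarrow> simple_rmodule R (submod M (S i))" "simple_rmodule R Q"
    and f: "f \<in> rmodule_hom R Q (submod M (support_module B))" "x \<in> carrier Q" "f x \<noteq> \<zero>\<^bsub>M\<^esub>"
  shows "\<exists>i\<in>I \<inter> B. rmodule_iso R Q (submod M (S i))"
proof -
  have fM: "f \<in> rmodule_hom R Q M"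
    using f(1) right_submodule_subset[OF support_submodule] by (auto simp: rmodule_hom_def)
  obtain i where i: "i \<in> I" "component (f x) i \<noteq> \<zero>\<^bsub>M\<^esub>"
    using ex_nonzero_component[OF rmodule_homD(1)[OF fM f(2)] f(3)] .
  have "i \<in> B" using rmodule_homD(1)[OF f(1,2)] i by (auto simp: support_module_def)
  interpret rmodule_homomorphism R Q "submod M (S i)" "(\<lambda>y. component y i) \<circ> f"
    using rmodule_hom_comp[OF fM component_hom[OF i(1)]] simple(2)
      right_module_submod[OF summand_submodule[OF i(1)]]
    by (simp add: rmodule_homomorphism_def rmodule_homomorphism_axioms_def simple_rmodule_def)
  have "rmodule_iso R Q (submod M (S i))"
    using simple_iso[OF simple(2) simple(1)[OF i(1)] f(2)] i by simp
  with i \<open>i \<in> B\<close> show ?thesis by blast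
qed

lemma support_direct_sum:
  assumes "B \<subseteq> I"
  shows "internal_direct_sum R (submod M (support_module B)) B S"
  unfolding internal_direct_sum_def
proof (intro conjI ballI)
  fix i assume i: "i \<in> B"
  with assms have "i \<in> I" by blast
  then show "right_submodule R (submod M (support_module B)) (S i)"
    using summand_submodule summand_le_support[OF i]
    by (simp add: right_submodule_submod_iff[OF support_submodule])
next
  let ?N = "submod M (support_module B)"
  fix x assume "x \<in> carrier ?N"
  then have xN: "x \<in> support_module B" and x: "x \<in> carrier M"
    and xB: "\<And>i. i \<in> I - B \<Longrightarrow> component x i = \<zero>\<^bsub>M\<^esub>" by (auto simp: support_module_def)
  have fs: "finsum ?N f {i \<in> B. f i \<noteq> \<zero>\<^bsub>M\<^esub>} = finsum M f {i \<in> B. f i \<noteq> \<zero>\<^bsub>M\<^esub>}"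
    if "f \<in> (\<Pi>\<^sub>E i\<in>B. S i)" "finite {i \<in> B. f i \<noteq> \<zero>\<^bsub>M\<^esub>}" for f
  proof (rule finsum_submod[OF support_submodule that(2)])
    fix i assume "i \<in> {i \<in> B. f i \<noteq> \<zero>\<^bsub>M\<^esub>}"
    then have "i \<in> B" "i \<in> I" "f i \<in> S i" using that(1) assms by auto
    then show "f i \<in> support_module B" using summand_le_support by blast
  qed
  show "\<exists>!f. f \<in> (\<Pi>\<^sub>E i\<in>B. S i) \<and> finite {i \<in> B. f i \<noteq> \<zero>\<^bsub>?N\<^esub>} \<and>
      x = finsum ?N f {i \<in> B. f i \<noteq> \<zero>\<^bsub>?N\<^esub>}"
    unfolding submod_simps
  proof (rule ex1I[of _ "restrict (component x) B"], intro conjI)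
    let ?f = "restrict (component x) B"
    have supp: "{i \<in> B. ?f i \<noteq> \<zero>\<^bsub>M\<^esub>} = {i \<in> I. component x i \<noteq> \<zero>\<^bsub>M\<^esub>}"
      using assms xB by auto
    show Pi: "?f \<in> (\<Pi>\<^sub>E i\<in>B. S i)" using component_mem[OF x] assms by auto
    show fin: "finite {i \<in> B. ?f i \<noteq> \<zero>\<^bsub>M\<^esub>}"
      unfolding supp using finite_component[OF x] .
    have "finsum M ?f {i \<in> B. ?f i \<noteq> \<zero>\<^bsub>M\<^esub>} = finsum M (component x) {i \<in> I. component x i \<noteq> \<zero>\<^bsub>M\<^esub>}"
      unfolding supp using xB component_closed[OF x] by (intro M.finsum_cong') auto
    with fs[OF Pi fin] finsum_component[OF x]
    show "x = finsum ?N ?f {i \<in> B. ?f i \<noteq> \<zero>\<^bsub>M\<^esub>}" by metis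
  next
    fix f assume f: "f \<in> (\<Pi>\<^sub>E i\<in>B. S i) \<and> finite {i \<in> B. f i \<noteq> \<zero>\<^bsub>M\<^esub>} \<and>
      x = finsum ?N f {i \<in> B. f i \<noteq> \<zero>\<^bsub>M\<^esub>}"
    \<comment> \<open>Off B the family f is \<open>undefined\<close>, whereas
      \<open>component_finsum\<close> wants a family on all of I; ?g is the extension by
      zero.\<close>
    let ?F = "{i \<in> B. f i \<noteq> \<zero>\<^bsub>M\<^esub>}" and ?g = "\<lambda>i. if i \<in> B then f i else \<zero>\<^bsub>M\<^esub>"
    have fM: "f i \<in> carrier M" if "i \<in> B" for i
      using f that assms summandD(1)[of i "f i"] by blast
    have "x = finsum M f ?F" using f fs by simp
    also have "\<dots> = finsum M ?g ?F"
      using fM by (intro M.finsum_cong') auto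
    finally have xg: "x = finsum M ?g ?F" .
    have "component x i = ?g i" if i: "i \<in> I" for i
    proof -
      have "component (finsum M ?g ?F) i = ?g i"
      proof (rule component_finsum[OF _ _ _ _ i])
        show "?g j \<in> S j" if "j \<in> I" for j
          using f that summandD(2) by auto
        show "finite ?F" using f by blast
      qed (use assms in auto)
      then show ?thesis by (simp only: xg[symmetric])
    qed
    then show "f = restrict (component x) B"
      using f assms by (intro extensionalityI[of _ B]) (auto simp: PiE_def)
  qed
qed

text \<open>Associativity of direct sums: the summands of one colour are collected into a block. A
  colour of J that c never takes contributes the zero block. Uniqueness holds because the i-th
  component of a sum of block elements comes from block c i alone.\<close>

lemma grouped_direct_sum:
  assumes c: "c ` I \<subseteq> J"
  shows "internal_direct_sum R M J (\<lambda>j. support_module {i\<in>I. c i = j})"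
  unfolding internal_direct_sum_def
proof (intro conjI ballI support_submodule)
  let ?H = "\<lambda>j. support_module {i\<in>I. c i = j}"
  fix x assume x: "x \<in> carrier M"
  have "\<exists>y\<in>?H j. \<forall>i\<in>I. component y i = (if c i = j then component x i else \<zero>\<^bsub>M\<^esub>)" for j
  proof -
    obtain p where "p \<in> rmodule_hom R M (submod M (?H j))"
      "\<And>y i. y \<in> carrier M \<Longrightarrow> i \<in> I \<Longrightarrow>
        component (p y) i = (if i \<in> {i\<in>I. c i = j} then component y i else \<zero>\<^bsub>M\<^esub>)"
      using ex_projection[of "{i\<in>I. c i = j}"] by blast
    then show ?thesis using rmodule_homD(1)[of p R M "submod M (?H j)" x] x
      by (intro bexI[of _ "p x"]) auto
  qed
  then obtain h where h: "\<And>j. h j \<in> ?H j"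
    "\<And>i j. i \<in> I \<Longrightarrow> component (h j) i = (if c i = j then component x i else \<zero>\<^bsub>M\<^esub>)" by metis
  have hM: "h j \<in> carrier M" for j using h(1) by (simp add: support_module_def)
  have sum: "component (finsum M f {j\<in>J. f j \<noteq> \<zero>\<^bsub>M\<^esub>}) i = component (f (c i)) i"
    if f: "\<And>j. j \<in> J \<Longrightarrow> f j \<in> ?H j" "finite {j\<in>J. f j \<noteq> \<zero>\<^bsub>M\<^esub>}" and i: "i \<in> I" for f i
  proof -
    let ?F = "{j\<in>J. f j \<noteq> \<zero>\<^bsub>M\<^esub>}"
    have fM: "f j \<in> carrier M" if "j \<in> J" for j using f(1)[OF that] by (simp add: support_module_def)
    have ci: "c i \<in> J" using c i by blast
    have "component (finsum M f ?F) i = finsum M (\<lambda>j. component (f j) i) ?F"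
      using f(2) fM i by (intro component_of_finsum) auto
    \<comment> \<open>The index c i need not lie in ?F; adding it changes nothing, since its term is
      then zero, and lets the sum collapse to that one term.\<close>
    also have "\<dots> = finsum M (\<lambda>j. if c i = j then component (f j) i else \<zero>\<^bsub>M\<^esub>) (insert (c i) ?F)"
    proof (rule M.add.finprod_mono_neutral_cong_left)
      show "component (f j) i = (if c i = j then component (f j) i else \<zero>\<^bsub>M\<^esub>)" if "j \<in> ?F" for j
        using f(1)[of j] that i by (auto simp: support_module_def)
      show "(\<lambda>j. if c i = j then component (f j) i else \<zero>\<^bsub>M\<^esub>) \<in> insert (c i) ?F \<rightarrow> carrier M"
        using component_closed[OF fM i] ci by auto
    qed (use f(2) i ci in \<open>auto simp: component_zero\<close>)
    also have "\<dots> = component (f (c i)) i"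
      using f(2) component_closed[OF fM i] ci by (intro M.finsum_singleton) auto
    finally show ?thesis .
  qed
  show "\<exists>!f. f \<in> (\<Pi>\<^sub>E j\<in>J. ?H j) \<and> finite {j\<in>J. f j \<noteq> \<zero>\<^bsub>M\<^esub>} \<and> x = finsum M f {j\<in>J. f j \<noteq> \<zero>\<^bsub>M\<^esub>}"
  proof (rule ex1I[of _ "restrict h J"], intro conjI)
    let ?f = "restrict h J"
    show Pi: "?f \<in> (\<Pi>\<^sub>E j\<in>J. ?H j)" using h(1) by auto
    have "{j\<in>J. ?f j \<noteq> \<zero>\<^bsub>M\<^esub>} \<subseteq> c ` {i\<in>I. component x i \<noteq> \<zero>\<^bsub>M\<^esub>}"
    proof
      fix j assume "j \<in> {j\<in>J. ?f j \<noteq> \<zero>\<^bsub>M\<^esub>}"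
      then have "h j \<noteq> \<zero>\<^bsub>M\<^esub>" by auto
      then obtain i where "i \<in> I" "component (h j) i \<noteq> \<zero>\<^bsub>M\<^esub>"
        using ex_nonzero_component[OF hM] by blast
      then show "j \<in> c ` {i\<in>I. component x i \<noteq> \<zero>\<^bsub>M\<^esub>}" using h(2)[of i j] by (auto split: if_splits)
    qed
    then show fin: "finite {j\<in>J. ?f j \<noteq> \<zero>\<^bsub>M\<^esub>}"
      using finite_component[OF x] finite_surj by blast
    show "x = finsum M ?f {j\<in>J. ?f j \<noteq> \<zero>\<^bsub>M\<^esub>}"
    proof (rule component_eqI[OF x])
      show "finsum M ?f {j\<in>J. ?f j \<noteq> \<zero>\<^bsub>M\<^esub>} \<in> carrier M"
        using hM by (intro M.finsum_closed) auto
      fix i assume i: "i \<in> I"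
      then have "c i \<in> J" using c by blast
      then have "component (?f (c i)) i = component x i" using h(2)[OF i] by simp
      moreover have "component (finsum M ?f {j\<in>J. ?f j \<noteq> \<zero>\<^bsub>M\<^esub>}) i = component (?f (c i)) i"
        using h(1) by (intro sum[OF _ fin i]) simp
      ultimately show "component x i = component (finsum M ?f {j\<in>J. ?f j \<noteq> \<zero>\<^bsub>M\<^esub>}) i"
        by (simp only:)
    qed
  next
    fix f assume f: "f \<in> (\<Pi>\<^sub>E j\<in>J. ?H j) \<and> finite {j\<in>J. f j \<noteq> \<zero>\<^bsub>M\<^esub>} \<and>
      x = finsum M f {j\<in>J. f j \<noteq> \<zero>\<^bsub>M\<^esub>}"
    have fH: "f j \<in> ?H j" if "j \<in> J" for j using f that by blast
    have fx: "component x i = component (f (c i)) i" if "i \<in> I" for i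
      using sum[OF fH _ that] f by metis
    have "f j = h j" if j: "j \<in> J" for j
    proof (rule component_eqI)
      show "f j \<in> carrier M" using fH[OF j] by (simp add: support_module_def)
      fix i assume i: "i \<in> I"
      show "component (f j) i = component (h j) i"
        using fx[OF i] h(2)[OF i] fH[OF j] i by (auto simp: support_module_def)
    qed (rule hM)
    then show "f = restrict h J"
      using f by (intro extensionalityI[of _ J]) (auto simp: PiE_def)
  qed
qed

end

section \<open>Existence of the dimension\<close>

text \<open>
  The ordinals below the successor \<open>\<kappa>\<close> of an infinite cardinal exceeding the number of submodules
  suffice: by regularity of \<open>\<kappa>\<close>, the ranks of all submodules of a given submodule are bounded.
\<close>

lemma has_wdim_if_wf:
  fixes R :: "('r, 'x) ring_scheme" and M :: "('m, 'r, 'y) rmodule_scheme"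
  assumes M: "right_module R M"
    and wf: "wf {(K, N). right_submodule R M K \<and> right_submodule R M N \<and> K \<subseteq> N \<and>
      \<not> embeds R (submod M N) (submod M K)}"
  shows "has_wdim R M"
proof -
  interpret right_module R M by fact
  \<comment> \<open>The summand \<open>nat\<close> keeps the cardinal infinite when M is finite, and
    \<open>'m set\<close> makes it at least the number of submodules.\<close>
  define \<kappa> where "\<kappa> = cardSuc |UNIV :: (nat + 'm set) set|"
  have inf: "infinite (UNIV :: (nat + 'm set) set)" by simp
  have card: "Card_order \<kappa>" by (simp add: \<kappa>_def)
  then have wo: "Well_order \<kappa>" by (rule card_order_on_well_order_on)
  have inf_\<kappa>: "infinite (Field \<kappa>)"
    unfolding \<kappa>_def using inf by (simp add: cardSuc_finite)
  have reg: "regularCard \<kappa>"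
    unfolding \<kappa>_def using inf by (intro infinite_cardSuc_regularCard) auto
  \<comment> \<open>The initial segments of \<kappa> are the ordinals used as indices; they grow
    strictly with a.\<close>
  define B where "B a = Restr \<kappa> (underS \<kappa> a)" for a
  have FB: "Field (B a) = underS \<kappa> a" for a
    unfolding B_def using wo by (simp add: Field_Restr_ofilter wo_rel.underS_ofilter wo_rel_def)
  have B_wo: "Well_order (B a)" for a
    unfolding B_def using wo by (rule Well_order_Restr)
  have B_mono: "B a <o B b" if "(a, b) \<in> \<kappa>" "a \<noteq> b" for a b
  proof -
    have "underS \<kappa> a \<subseteq> underS \<kappa> b"
      using that(1) wo by (intro underS_incr) (simp_all add: order_on_defs)
    moreover have "a \<in> underS \<kappa> b" "a \<notin> underS \<kappa> a" using that by (simp_all add: underS_def)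
    ultimately show ?thesis unfolding B_def
      using ofilter_subset_ordLess[OF wo, of "underS \<kappa> a" "underS \<kappa> b"] wo
      by (auto simp: wo_rel_def wo_rel.underS_ofilter)
  qed
  \<comment> \<open>A family indexed by submodules has fewer than \<kappa> values, so by regularity
    it is not cofinal: some c has no value strictly above it, and totality turns c into an upper
    bound.\<close>
  have bounded: "\<exists>c\<in>Field \<kappa>. \<forall>x\<in>Y. (g x, c) \<in> \<kappa>"
    if g: "\<And>x. x \<in> Y \<Longrightarrow> g x \<in> Field \<kappa>" for Y :: "'m set set" and g
  proof -
    have "|g ` Y| \<le>o |Y|" by (rule card_of_image)
    also have "|Y| \<le>o |UNIV :: (nat + 'm set) set|"
      using card_of_ordLeq[of Y "UNIV :: (nat + 'm set) set"] by (auto intro: exI[of _ Inr])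
    also have "|UNIV :: (nat + 'm set) set| <o \<kappa>"
      unfolding \<kappa>_def by (intro cardSuc_greater card_of_Card_order)
    finally have "\<not> |g ` Y| =o \<kappa>" using not_ordLess_ordIso by blast
    with reg g have "\<not> cofinal (g ` Y) \<kappa>" unfolding regularCard_def by blast
    then obtain c where c: "c \<in> Field \<kappa>" "\<And>x. x \<in> Y \<Longrightarrow> \<not> (c \<noteq> g x \<and> (c, g x) \<in> \<kappa>)"
      unfolding cofinal_def by blast
    have "(g x, c) \<in> \<kappa>" if "x \<in> Y" for x
      using c(2)[OF that] wo_rel.TOTALS[of \<kappa>] wo c(1) g[OF that] by (metis wo_rel_def)
    with c(1) show ?thesis by blast
  qed
  have limit: "\<exists>b\<in>Field \<kappa>. a \<noteq> b \<and> (a, b) \<in> \<kappa>" if "a \<in> Field \<kappa>" for a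
    using infinite_Card_order_limit[OF card inf_\<kappa> that] .
  have ne: "a \<noteq> c" if "(a, b) \<in> \<kappa>" "(b, c) \<in> \<kappa>" "b \<noteq> c" for a b c
    using that wo by (auto simp: order_on_defs dest: antisymD)
  have tr: "(a, c) \<in> \<kappa>" if "(a, b) \<in> \<kappa>" "(b, c) \<in> \<kappa>" for a b c
    using that wo by (auto simp: order_on_defs dest: transD)
  have *: "\<exists>a\<in>Field \<kappa>. wu_class R (B a) (submod M N)"
    if "right_submodule R M N" "N \<noteq> {\<zero>\<^bsub>M\<^esub>}" for N
    using that
  proof (induction N rule: wf_induct_rule[OF wf])
    case (1 N)
    define Y where "Y = {K. right_submodule R M K \<and> K \<subseteq> N \<and> K \<noteq> {\<zero>\<^bsub>M\<^esub>} \<and>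
      \<not> embeds R (submod M N) (submod M K)}"
    have "\<exists>a\<in>Field \<kappa>. wu_class R (B a) (submod M K)" if "K \<in> Y" for K
      using that 1 by (auto simp: Y_def)
    then obtain g where g: "\<And>K. K \<in> Y \<Longrightarrow> g K \<in> Field \<kappa>"
      "\<And>K. K \<in> Y \<Longrightarrow> wu_class R (B (g K)) (submod M K)" by metis
    obtain c where c: "c \<in> Field \<kappa>" "\<And>K. K \<in> Y \<Longrightarrow> (g K, c) \<in> \<kappa>" using bounded[of Y g] g(1) by blast
    \<comment> \<open>Two steps above the bound c: d and e lie strictly above c, so
      \<open>B e\<close> contains both c and d. Its index thus exceeds one, which selects the
      recursive clause, and every rank g K is strictly smaller.\<close>
    obtain d where d: "d \<in> Field \<kappa>" "c \<noteq> d" "(c, d) \<in> \<kappa>" using limit[OF c(1)] by blast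
    obtain e where e: "e \<in> Field \<kappa>" "d \<noteq> e" "(d, e) \<in> \<kappa>" using limit[OF d(1)] by blast
    have "{c, d} \<subseteq> Field (B e)"
      using d e ne[OF d(3) e(3) e(2)] tr[OF d(3) e(3)] by (auto simp: FB underS_def)
    then have F: "Field (B e) \<noteq> {}" "\<nexists>u. Field (B e) = {u}" using d(2) by auto
    have "\<exists>\<beta> :: (nat + 'm set) set rel. \<beta> <o B e \<and> wu_class R \<beta> (submod M K)" if "K \<in> Y" for K
    proof -
      have "(g K, d) \<in> \<kappa>" using c(2)[OF that] d(3) tr by blast
      then have "B (g K) <o B e" using e ne tr by (intro B_mono) blast+
      with g(2)[OF that] show ?thesis by blast
    qed
    then have "wu_class R (B e) (submod M N)"
      unfolding wu_class_gt_one_iff[OF F]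
      using right_module_submod[OF 1(2)] 1(3) B_wo right_submodule_submod_iff[OF 1(2)]
      by (auto simp: zero_module_def Y_def)
    with e(1) show ?case by blast
  qed
  show ?thesis
  proof (cases "zero_module M")
    case True
    then show ?thesis by (auto simp: has_wdim_def is_wdim_def)
  next
    case False
    then obtain a where "wu_class R (B a) M"
      using *[OF right_submodule_carrier] by (auto simp: zero_module_def)
    then obtain \<gamma> :: "(nat + 'm set) set rel" where "wu_class R \<gamma> M"
      "\<And>\<beta> :: (nat + 'm set) set rel. wu_class R \<beta> M \<Longrightarrow> \<gamma> \<le>o \<beta>"
      using wu_class_least by blast
    with False have "is_wdim R M \<gamma>" by (simp add: is_wdim_def)
    \<comment> \<open>\<gamma> lives on a larger type than the one in \<open>has_wdim\<close>; the
      transfer lemma brings the dimension back to well-orders on \<open>'m set\<close>.\<close>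
    then show ?thesis by (rule has_wdim_if_is_wdim)
  qed
qed

section \<open>Semisimple modules\<close>

locale simple_decomposition = direct_decomposition R M \<A> "\<lambda>S. S"
  for R :: "('r, 'x) ring_scheme" (structure) and M :: "('m, 'r, 'y) rmodule_scheme" (structure)
    and \<A> :: "'m set set" +
  assumes simple: "S \<in> \<A> \<Longrightarrow> simple_rmodule R (submod M S)"
begin

lemma simple_summandD:
  assumes "S \<in> \<A>"
  shows "S \<noteq> {\<zero>\<^bsub>M\<^esub>}" "right_submodule R M K \<Longrightarrow> K \<subseteq> S \<Longrightarrow> K \<noteq> {\<zero>\<^bsub>M\<^esub>} \<Longrightarrow> K = S"
  using simple[OF assms] unfolding simple_submod_iff[OF summand_submodule[OF assms]] by blast+

lemma ex_nonzero:
  assumes "S \<in> \<A>"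
  obtains x where "x \<in> S" "x \<in> carrier M" "x \<noteq> \<zero>\<^bsub>M\<^esub>"
  using simple_summandD(1)[OF assms] summandD(1,2)[OF assms] by blast

lemma support_empty: "support_module {} = {\<zero>\<^bsub>M\<^esub>}"
proof
  show "support_module {} \<subseteq> {\<zero>\<^bsub>M\<^esub>}"
    by (rule support_module_least[OF right_submodule_zero]) simp
  show "{\<zero>\<^bsub>M\<^esub>} \<subseteq> support_module {}"
    using right_submoduleD(2)[OF support_submodule] by simp
qed

text \<open>
  Every submodule \<open>N\<close> has a complement spanned by a maximal set \<open>C\<close> of summands that is
  independent of \<open>N\<close>, so \<open>N\<close> is isomorphic to the span of the remaining summands.
\<close>

lemma submodule_iso_support:
  assumes N: "right_submodule R M N"
  shows "\<exists>B\<subseteq>\<A>. rmodule_iso R (submod M N) (submod M (support_module B))"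
proof -
  define \<F> where "\<F> = {C. C \<subseteq> \<A> \<and> N \<inter> support_module C = {\<zero>\<^bsub>M\<^esub>}}"
  note N0 = right_submoduleD(2)[OF N] and sup0 = right_submoduleD(2)[OF support_submodule]
  have "\<exists>C\<in>\<F>. \<forall>D\<in>\<F>. C \<subseteq> D \<longrightarrow> D = C"
  proof (rule subset_Zorn_nonempty)
    have "{} \<in> \<F>" using N0 by (simp add: \<F>_def support_empty)
    then show "\<F> \<noteq> {}" by blast
  next
    fix \<C> assume ne: "\<C> \<noteq> {}" and chain: "subset.chain \<F> \<C>"
    then have sub: "\<C> \<subseteq> \<F>" by (simp add: subset.chain_def)
    \<comment> \<open>Finiteness of the support is what makes Zorn's lemma applicable: the support
      of x already lies in one member of the chain.\<close>
    have "x = \<zero>\<^bsub>M\<^esub>" if x: "x \<in> N" "x \<in> support_module (\<Union>\<C>)" for x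
    proof -
      have xM: "x \<in> carrier M" and xs: "{S\<in>\<A>. component x S \<noteq> \<zero>\<^bsub>M\<^esub>} \<subseteq> \<Union>\<C>"
        using x(2) by (auto simp: support_module_def)
      obtain C where C: "C \<in> \<C>" "{S\<in>\<A>. component x S \<noteq> \<zero>\<^bsub>M\<^esub>} \<subseteq> C"
        using finite_subset_Union_chain[OF finite_component[OF xM] xs ne chain] .
      then have "x \<in> support_module C" using xM by (auto simp: support_module_def)
      with C(1) sub x(1) show ?thesis by (auto simp: \<F>_def)
    qed
    then have "N \<inter> support_module (\<Union>\<C>) = {\<zero>\<^bsub>M\<^esub>}" using N0 sup0[of "\<Union>\<C>"] by blast
    moreover have "\<Union>\<C> \<subseteq> \<A>" using sub unfolding \<F>_def by blast
    ultimately show "\<Union>\<C> \<in> \<F>" by (simp add: \<F>_def)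
  qed
  then obtain C where C: "C \<subseteq> \<A>" "N \<inter> support_module C = {\<zero>\<^bsub>M\<^esub>}"
    and max: "\<And>D. D \<in> \<F> \<Longrightarrow> C \<subseteq> D \<Longrightarrow> D = C" by (auto simp: \<F>_def)
  define B where "B = \<A> - C"
  obtain p where p: "p \<in> rmodule_hom R M (submod M (support_module B))"
    and pc: "\<And>x S. x \<in> carrier M \<Longrightarrow> S \<in> \<A> \<Longrightarrow>
      component (p x) S = (if S \<in> B then component x S else \<zero>\<^bsub>M\<^esub>)"
    using ex_projection[of B] by blast
  have pM: "p x \<in> carrier M" if "x \<in> carrier M" for x
    using rmodule_homD(1)[OF p that] by (simp add: support_module_def)
  interpret p: rmodule_homomorphism R "submod M N" "submod M (support_module B)" p
    using rmodule_hom_restrict_dom[OF p right_submodule_subset[OF N]]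
      right_module_submod[OF N] right_module_submod[OF support_submodule]
    by (simp add: rmodule_homomorphism_def rmodule_homomorphism_axioms_def)
  \<comment> \<open>The kernel of p is the span of C, which meets N only in zero.\<close>
  have "x = \<zero>\<^bsub>M\<^esub>" if x: "x \<in> N" "p x = \<zero>\<^bsub>M\<^esub>" for x
  proof -
    have xM: "x \<in> carrier M" using right_submoduleD(1)[OF N x(1)] .
    have "component x S = \<zero>\<^bsub>M\<^esub>" if "S \<in> \<A> - C" for S
      using that pc[OF xM, of S] by (simp add: B_def x(2) component_zero)
    with xM have "x \<in> support_module C" by (simp add: support_module_def)
    with C(2) x(1) show ?thesis by blast
  qed
  then have inj: "inj_on p N" using p.inj_iff by simp
  have img: "right_submodule R M (p ` N)" "p ` N \<subseteq> support_module B"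
    using p.image_submodule[OF p.A.right_submodule_carrier]
      right_submodule_submod_iff[OF support_submodule] by auto
  have "S \<subseteq> p ` N" if S: "S \<in> \<A> \<inter> B" for S
  proof -
    have SA: "S \<in> \<A>" "S \<notin> C" using S by (auto simp: B_def)
    \<comment> \<open>Maximality of C yields x in N whose only nonzero component outside C is the
      one at S. Its image under p is exactly that component, so the image of N meets S and, by
      simplicity, contains it.\<close>
    then have "insert S C \<notin> \<F>" using max[of "insert S C"] by blast
    then have "N \<inter> support_module (insert S C) \<noteq> {\<zero>\<^bsub>M\<^esub>}" using SA C(1) by (simp add: \<F>_def)
    then obtain x where x: "x \<in> N" "x \<in> support_module (insert S C)" "x \<noteq> \<zero>\<^bsub>M\<^esub>"
      using N0 sup0[of "insert S C"] by blast
    have xM: "x \<in> carrier M" using right_submoduleD(1)[OF N x(1)] .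
    have "x \<notin> support_module C" using x C(2) by blast
    with x(2) have nz: "component x S \<noteq> \<zero>\<^bsub>M\<^esub>" by (auto simp: support_module_def)
    have "p x = component x S"
    proof (rule component_eqI[OF pM[OF xM] component_closed[OF xM SA(1)]])
      fix T assume T: "T \<in> \<A>"
      show "component (p x) T = component (component x S) T"
        using pc[OF xM T] x(2) T S component_summand[OF SA(1) component_mem[OF xM SA(1)] T]
        by (auto simp: support_module_def B_def)
    qed
    then have "component x S \<in> S \<inter> p ` N" using x(1) component_mem[OF xM SA(1)] by force
    with nz have "S \<inter> p ` N \<noteq> {\<zero>\<^bsub>M\<^esub>}" by blast
    with simple_summandD(2)[OF SA(1) right_submodule_Int[OF summand_submodule[OF SA(1)] img(1)]]
    show ?thesis by blast
  qed
  then have "p ` N = support_module B"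
    using support_module_least[OF img(1), of B] img(2) by blast
  with inj p.hom have "rmodule_iso R (submod M N) (submod M (support_module B))"
    by (auto simp: rmodule_iso_def bij_betw_def)
  then show ?thesis unfolding B_def by blast
qed

section \<open>From finitely many isomorphism types to a dimension\<close>

lemma has_wdim_if_finitely_many_types:
  assumes c: "\<And>S. S \<in> \<A> \<Longrightarrow> c S < (n :: nat)"
    and iso: "\<And>S T. S \<in> \<A> \<Longrightarrow> T \<in> \<A> \<Longrightarrow> c S = c T \<Longrightarrow> rmodule_iso R (submod M S) (submod M T)"
  shows "has_wdim R M"
proof (rule has_wdim_if_wf[OF right_module_axioms])
  let ?r = "{(K, N). right_submodule R M K \<and> right_submodule R M N \<and> K \<subseteq> N \<and>
      \<not> embeds R (submod M N) (submod M K)}"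
  have "\<exists>B. right_submodule R M N \<longrightarrow>
      B \<subseteq> \<A> \<and> rmodule_iso R (submod M N) (submod M (support_module B))" for N
    using submodule_iso_support by blast
  then obtain B where B: "\<And>N. right_submodule R M N \<Longrightarrow> B N \<subseteq> \<A>"
    "\<And>N. right_submodule R M N \<Longrightarrow> rmodule_iso R (submod M N) (submod M (support_module (B N)))"
    by metis
  \<comment> \<open>Multiplicities are cardinals, taken as well-orders, so infinite ones are covered
    and a strict drop is well-founded because \<open><o\<close> is.\<close>
  define mult where "mult i N = |{S \<in> B N. c S = i}|" for i N
  have embeds: "embeds R (submod M N) (submod M K)"
    if N: "right_submodule R M N" and K: "right_submodule R M K"
      and le: "\<And>i. i < n \<Longrightarrow> mult i N \<le>o mult i K" for N K
  proof -
    have "\<forall>i\<in>{..<n}. \<exists>g. inj_on g {S \<in> B N. c S = i} \<and>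
        g ` {S \<in> B N. c S = i} \<subseteq> {S \<in> B K. c S = i}"
      using le by (auto simp: mult_def card_of_ordLeq)
    from bchoice[OF this] obtain g where "\<forall>i\<in>{..<n}. inj_on (g i) {S \<in> B N. c S = i} \<and>
        g i ` {S \<in> B N. c S = i} \<subseteq> {S \<in> B K. c S = i}" ..
    then have g: "\<And>i. i < n \<Longrightarrow> inj_on (g i) {S \<in> B N. c S = i}"
      "\<And>i. i < n \<Longrightarrow> g i ` {S \<in> B N. c S = i} \<subseteq> {S \<in> B K. c S = i}"
      by simp_all
    have gB: "g (c S) S \<in> B K" "c (g (c S) S) = c S" if "S \<in> B N" for S
      using g(2)[of "c S"] c that B(1)[OF N] by auto
    have "embeds R (submod M (support_module (B N))) (submod M (support_module (B K)))"
    proof (rule support_module_embeds[OF B(1)[OF N] B(1)[OF K]])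
      \<comment> \<open>The maps for the different colours glue to an injection because each
        preserves the colour.\<close>
      show "inj_on (\<lambda>S. g (c S) S) (B N)"
      proof (rule inj_onI)
        fix S T assume ST: "S \<in> B N" "T \<in> B N" "g (c S) S = g (c T) T"
        then have "c S = c T" using gB(2) by metis
        with ST g(1)[of "c S"] c[of S] B(1)[OF N] show "S = T" by (auto dest: inj_onD)
      qed
      show "(\<lambda>S. g (c S) S) ` B N \<subseteq> B K" using gB(1) by blast
      show "embeds R (submod M S) (submod M (g (c S) S))" if "S \<in> B N" for S
        using that gB[OF that] B(1)[OF N] B(1)[OF K]
        by (intro rmodule_iso_imp_embeds iso) auto
    qed
    with rmodule_iso_imp_embeds[OF B(2)[OF N]]
      rmodule_iso_imp_embeds[OF rmodule_iso_sym[OF right_module_submod[OF K] B(2)[OF K]]]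
    show ?thesis using embeds_trans by blast
  qed
  show "wf ?r"
  proof (rule trans_disj_wf_implies_wf)
    show "trans ?r"
    proof (rule transI)
      fix K N L assume "(K, N) \<in> ?r" "(N, L) \<in> ?r"
      \<comment> \<open>Nestedness is used here: since N \<subseteq> L, an embedding of L into K
        would restrict to one of N into K.\<close>
      moreover from this have "embeds R (submod M N) (submod M L)" by (auto intro: embeds_submod)
      ultimately show "(K, L) \<in> ?r" using embeds_trans by blast
    qed
    have "wf {(K, N). mult i K <o mult i N}" for i
      using wf_inv_image[OF wf_ordLess, of "mult i"] by (simp add: inv_image_def)
    moreover have "?r \<subseteq> (\<Union>i<n. {(K, N). mult i K <o mult i N})"
    proof safe
      fix K N assume KN: "right_submodule R M K" "right_submodule R M N"
        "\<not> embeds R (submod M N) (submod M K)"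
      then obtain i where "i < n" "\<not> mult i N \<le>o mult i K" using embeds by blast
      then show "(K, N) \<in> (\<Union>i<n. {(K, N). mult i K <o mult i N})"
        by (auto simp: mult_def)
    qed
    ultimately show "disj_wf ?r"
      unfolding disj_wf
      by (intro exI[of _ "\<lambda>i. {(K, N). mult i K <o mult i N}"] exI[of _ n] conjI allI impI)
  qed
qed

section \<open>Isomorphism types of summands and the converse\<close>

text \<open>The isomorphism class of S among the fixed summands. As a set it turns isomorphism of
  summands into equality, so finiteness of the number of types becomes finiteness of an
  image.\<close>

definition iso_type :: "'m set \<Rightarrow> 'm set set" where
  "iso_type S = {T \<in> \<A>. rmodule_iso R (submod M S) (submod M T)}"

lemma iso_type_eq_iff:
  assumes "S \<in> \<A>" "T \<in> \<A>"
  shows "iso_type S = iso_type T \<longleftrightarrow> rmodule_iso R (submod M S) (submod M T)"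
proof
  assume "iso_type S = iso_type T"
  moreover have "T \<in> iso_type T" using assms by (simp add: iso_type_def rmodule_iso_refl)
  ultimately have "T \<in> iso_type S" by simp
  then show "rmodule_iso R (submod M S) (submod M T)" by (simp add: iso_type_def)
next
  assume ST: "rmodule_iso R (submod M S) (submod M T)"
  moreover have "rmodule_iso R (submod M T) (submod M S)"
    using rmodule_iso_sym[OF right_module_submod[OF summand_submodule[OF assms(1)]] ST] .
  ultimately show "iso_type S = iso_type T"
    by (auto simp: iso_type_def intro: rmodule_iso_trans)
qed

text \<open>The obstruction to embeddings in the converse: the span of B can only receive a simple
  summand whose type occurs in B.\<close>

lemma embedded_summand_type:
  assumes "S \<in> \<A>" "embeds R (submod M S) (submod M (support_module B))"
  obtains T where "T \<in> \<A> \<inter> B" "iso_type S = iso_type T"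
proof -
  obtain f where f: "f \<in> rmodule_hom R (submod M S) (submod M (support_module B))" "inj_on f S"
    using assms(2) by (auto simp: embeds_def)
  interpret f: rmodule_homomorphism R "submod M S" "submod M (support_module B)" f
    using f(1) right_module_submod[OF summand_submodule[OF assms(1)]]
      right_module_submod[OF support_submodule]
    by (simp add: rmodule_homomorphism_def rmodule_homomorphism_axioms_def)
  obtain x where x: "x \<in> S" "x \<noteq> \<zero>\<^bsub>M\<^esub>" using ex_nonzero[OF assms(1)] by blast
  then have "f x \<noteq> \<zero>\<^bsub>M\<^esub>" using f.inj_iff f(2) by auto
  then obtain T where "T \<in> \<A> \<inter> B" "rmodule_iso R (submod M S) (submod M T)"
    using simple_iso_summand[OF simple simple[OF assms(1)] f(1)] x(1) by auto
  then show thesis using that iso_type_eq_iff[OF assms(1)] by blast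
qed

text \<open>
  Removing one isomorphism type leaves infinitely many and yields a submodule into which the whole
  module does not embed, so the minimal ordinal of such a module could always be lowered.
\<close>

lemma not_wu_class_if_infinitely_many_types:
  fixes \<alpha> :: "'o rel"
  assumes "B \<subseteq> \<A>" "infinite (iso_type ` B)"
  shows "\<not> wu_class R \<alpha> (submod M (support_module B))"
  using assms
proof (induction \<alpha> arbitrary: B rule: wf_induct_rule[OF wf_ordLess])
  case (1 \<alpha>)
  let ?M = "\<lambda>B. submod M (support_module B)"
  show ?case
  proof
    assume wu: "wu_class R \<alpha> (?M B)"
    have "B \<noteq> {}" using 1(3) by auto
    then obtain S where S: "S \<in> B" by blast
    then have SA: "S \<in> \<A>" using 1(2) by blast
    \<comment> \<open>The entire type of S is dropped; removing S alone could leave another summand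
      of its type into which S embeds.\<close>
    define B' where "B' = {T \<in> B. iso_type T \<noteq> iso_type S}"
    have B': "B' \<subseteq> \<A>" "B' \<subseteq> B" using 1(2) by (auto simp: B'_def)
    have types: "iso_type ` B \<subseteq> insert (iso_type S) (iso_type ` B')" by (auto simp: B'_def)
    have inf: "infinite (iso_type ` B')"
    proof
      assume "finite (iso_type ` B')"
      then have "finite (iso_type ` B)" using finite_subset[OF types] by simp
      with 1(3) show False ..
    qed
    then have "B' \<noteq> {}" by auto
    then obtain T where T: "T \<in> B'" by blast
    then have TA: "T \<in> \<A>" using B'(1) by blast
    have sub: "S' \<subseteq> support_module C" if "S' \<in> C" "C \<subseteq> \<A>" for S' C
      using that summand_le_support by blast
    have nemb: "\<not> embeds R (submod M S) (?M B')"
    proof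
      assume "embeds R (submod M S) (?M B')"
      from embedded_summand_type[OF SA this] obtain S' where "S' \<in> B'" "iso_type S = iso_type S'"
        by blast
      then show False by (simp add: B'_def)
    qed
    show False
    proof (cases "\<exists>u. Field \<alpha> = {u}")
      case True
      then obtain u where u: "Field \<alpha> = {u}" by blast
      have "right_submodule R (?M B) S" "right_submodule R (?M B) T"
        using S T SA TA B'(2) sub[OF _ 1(2)] summand_submodule
        by (auto simp: right_submodule_submod_iff[OF support_submodule])
      moreover have "weakly_uniserial R (?M B)" using wu unfolding wu_class_one_iff[OF u] by blast
      ultimately consider "embeds R (submod M S) (submod M T)" | "embeds R (submod M T) (submod M S)"
        unfolding weakly_uniserial_def by fastforce
      then show False
      proof cases
        case 1
        then show False
          using nemb embeds_trans embeds_submod[OF sub[OF T B'(1)]] by blast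
      next
        case 2
        \<comment> \<open>S lies in the span of {S}, where the only possible partner for T is S
          itself, and T has another type.\<close>
        then have "embeds R (submod M T) (?M {S})"
          using embeds_trans embeds_submod[OF sub[of S "{S}"]] SA by blast
        with embedded_summand_type[OF TA this] T show False by (auto simp: B'_def)
      qed
    next
      case False
      have le: "support_module B' \<subseteq> support_module B" using support_module_mono[OF B'(2)] .
      have "right_submodule R (?M B) (support_module B')"
        using le by (simp add: right_submodule_submod_iff[OF support_submodule] support_submodule)
      moreover have "support_module B' \<noteq> {\<zero>\<^bsub>M\<^esub>}"
        using sub[OF T B'(1)] ex_nonzero[OF TA] by blast
      moreover have not: "\<not> embeds R (?M B) (?M B')"
        using nemb embeds_trans embeds_submod[OF sub[OF S 1(2)]] by blast
      moreover have "support_module B' \<noteq> support_module B"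
        using not embeds_submod[of "support_module B" "support_module B'"] by auto
      ultimately have "\<exists>\<beta> :: 'o rel. \<beta> <o \<alpha> \<and> wu_class R \<beta> (?M B')"
        using wu unfolding wu_class_gt_one_iff[OF wu_classD(2)[OF wu] False] by simp
      then show False using 1(1)[OF _ B'(1) inf] by blast
    qed
  qed
qed

lemma finitely_many_types_if_has_wdim:
  assumes "has_wdim R M"
  shows "finite (iso_type ` \<A>)"
proof (cases "zero_module M")
  case True
  \<comment> \<open>The zero module gets its dimension from a separate clause without any class, but
    it has no simple summands at all.\<close>
  then have "\<A> = {}" using ex_nonzero by (auto simp: zero_module_def)
  then show ?thesis by simp
next
  case False
  with assms obtain \<alpha> :: "'m set rel" where "wu_class R \<alpha> M"
    by (auto simp: has_wdim_def is_wdim_def)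
  then show ?thesis
    using not_wu_class_if_infinitely_many_types[of \<A> \<alpha>] by (auto simp: support_module_I)
qed

section \<open>Isomorphism types versus homogeneous decompositions\<close>

lemma homogeneous_support:
  assumes "B \<subseteq> \<A>" "\<And>S T. S \<in> B \<Longrightarrow> T \<in> B \<Longrightarrow> rmodule_iso R (submod M S) (submod M T)"
  shows "homogeneous_semisimple R (submod M (support_module B))"
  unfolding homogeneous_semisimple_def
  using assms simple right_module_submod[OF support_submodule] support_direct_sum[OF assms(1)]
  by (intro conjI exI[of _ B]) auto

text \<open>The finitely many types are numbered by h, and the summands carrying the same number
  form one homogeneous block.\<close>

lemma homogeneous_decomposition:
  assumes "finite (iso_type ` \<A>)"
  shows "\<exists>(n :: nat) H. internal_direct_sum R M {..<n} H \<and>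
    (\<forall>i<n. homogeneous_semisimple R (submod M (H i)))"
proof -
  obtain h where h: "bij_betw h (iso_type ` \<A>) {0..<card (iso_type ` \<A>)}"
    using ex_bij_betw_finite_nat[OF assms] by blast
  let ?n = "card (iso_type ` \<A>)" and ?c = "\<lambda>S. h (iso_type S)"
  let ?H = "\<lambda>i. support_module {S\<in>\<A>. ?c S = i}"
  have "?c ` \<A> \<subseteq> {..<?n}" using bij_betwE[OF h] by auto
  then have "internal_direct_sum R M {..<?n} ?H" by (rule grouped_direct_sum)
  moreover have "homogeneous_semisimple R (submod M (?H i))" for i
  proof (rule homogeneous_support)
    fix S T assume "S \<in> {S\<in>\<A>. ?c S = i}" "T \<in> {S\<in>\<A>. ?c S = i}"
    then show "rmodule_iso R (submod M S) (submod M T)"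
      using inj_onD[OF bij_betw_imp_inj_on[OF h], of "iso_type S" "iso_type T"]
      by (auto simp: iso_type_eq_iff)
  qed auto
  ultimately show ?thesis by blast
qed

text \<open>This links two unrelated decompositions: T need not lie in any H j. Projecting a nonzero
  element of T to a part H j where it survives, and from there to a simple summand of H j, gives a
  nonzero map of simple modules.\<close>

lemma summand_iso_homogeneous_part:
  assumes T: "simple_rmodule R (submod M T)" "right_submodule R M T"
    and sum: "internal_direct_sum R M J H"
    and \<B>: "\<And>j. j \<in> J \<Longrightarrow> internal_direct_sum R (submod M (H j)) (\<B> j) (\<lambda>S. S)"
      "\<And>j S. j \<in> J \<Longrightarrow> S \<in> \<B> j \<Longrightarrow> simple_rmodule R (submod (submod M (H j)) S)"
  shows "\<exists>j\<in>J. \<exists>S\<in>\<B> j. rmodule_iso R (submod M T) (submod (submod M (H j)) S)"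
proof -
  interpret H: direct_decomposition R M J H by unfold_locales (rule sum)
  obtain x where x: "x \<in> T" "x \<noteq> \<zero>\<^bsub>M\<^esub>"
    using T right_submoduleD(2)[OF T(2)] unfolding simple_submod_iff[OF T(2)] by blast
  have xM: "x \<in> carrier M" using right_submoduleD(1)[OF T(2) x(1)] .
  obtain j where j: "j \<in> J" "H.component x j \<noteq> \<zero>\<^bsub>M\<^esub>"
    using H.ex_nonzero_component[OF xM x(2)] .
  interpret Hj: right_module R "submod M (H j)"
    using right_module_submod[OF H.summand_submodule[OF j(1)]] .
  interpret \<B>: direct_decomposition R "submod M (H j)" "\<B> j" "\<lambda>S. S"
    by unfold_locales (rule \<B>(1)[OF j(1)])
  have "(\<lambda>y. H.component y j) \<in> rmodule_hom R (submod M T) (submod M (H j))"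
    using rmodule_hom_restrict_dom[OF H.component_hom[OF j(1)] right_submodule_subset[OF T(2)]] .
  moreover have "\<B>.support_module (\<B> j) = H j" using \<B>.support_module_I by simp
  ultimately show ?thesis
    using \<B>.simple_iso_summand[OF \<B>(2)[OF j(1)] T(1), of "\<lambda>y. H.component y j" "\<B> j" x] x j by auto
qed

text \<open>Colour each S by a block containing a simple summand isomorphic to S. Equal colours then
  mean isomorphic modules, by way of the pairwise isomorphic summands of that block.\<close>

lemma finite_iso_types_if_homogeneous_decomposition:
  assumes sum: "internal_direct_sum R M {..<(n :: nat)} H"
    and hom: "\<And>i. i < n \<Longrightarrow> homogeneous_semisimple R (submod M (H i))"
  shows "\<exists>c. \<forall>S\<in>\<A>. c S < n \<and>
    (\<forall>T\<in>\<A>. c S = c T \<longrightarrow> rmodule_iso R (submod M S) (submod M T))"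
proof -
  have "\<forall>i\<in>{..<n}. \<exists>\<B>. (\<forall>S\<in>\<B>. simple_rmodule R (submod (submod M (H i)) S)) \<and>
      internal_direct_sum R (submod M (H i)) \<B> (\<lambda>S. S) \<and>
      (\<forall>S\<in>\<B>. \<forall>T\<in>\<B>. rmodule_iso R (submod (submod M (H i)) S) (submod (submod M (H i)) T))"
    using hom by (simp add: homogeneous_semisimple_def)
  from bchoice[OF this] obtain \<B> where "\<forall>i\<in>{..<n}.
      (\<forall>S\<in>\<B> i. simple_rmodule R (submod (submod M (H i)) S)) \<and>
      internal_direct_sum R (submod M (H i)) (\<B> i) (\<lambda>S. S) \<and>
      (\<forall>S\<in>\<B> i. \<forall>T\<in>\<B> i. rmodule_iso R (submod (submod M (H i)) S) (submod (submod M (H i)) T))" ..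
  then have \<B>: "\<And>i S. i \<in> {..<n} \<Longrightarrow> S \<in> \<B> i \<Longrightarrow> simple_rmodule R (submod (submod M (H i)) S)"
    "\<And>i. i \<in> {..<n} \<Longrightarrow> internal_direct_sum R (submod M (H i)) (\<B> i) (\<lambda>S. S)"
    "\<And>i S T. i \<in> {..<n} \<Longrightarrow> S \<in> \<B> i \<Longrightarrow> T \<in> \<B> i \<Longrightarrow>
      rmodule_iso R (submod (submod M (H i)) S) (submod (submod M (H i)) T)"
    by blast+
  have "\<exists>i\<in>{..<n}. \<exists>S\<in>\<B> i. rmodule_iso R (submod M T) (submod (submod M (H i)) S)" if "T \<in> \<A>" for T
    using summand_iso_homogeneous_part[OF simple[OF that] summand_submodule[OF that] sum \<B>(2) \<B>(1)] .
  then obtain c s where c: "\<And>T. T \<in> \<A> \<Longrightarrow> c T \<in> {..<n}" "\<And>T. T \<in> \<A> \<Longrightarrow> s T \<in> \<B> (c T)"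
    "\<And>T. T \<in> \<A> \<Longrightarrow> rmodule_iso R (submod M T) (submod (submod M (H (c T))) (s T))"
    by metis
  have "rmodule_iso R (submod M S) (submod M T)" if "S \<in> \<A>" "T \<in> \<A>" "c S = c T" for S T
  proof -
    have "rmodule_iso R (submod (submod M (H (c S))) (s S)) (submod (submod M (H (c S))) (s T))"
      using \<B>(3)[OF c(1) c(2)] c(2)[OF that(2)] that by simp
    moreover have "rmodule_iso R (submod (submod M (H (c S))) (s T)) (submod M T)"
      using rmodule_iso_sym[OF right_module_submod[OF summand_submodule[OF that(2)]] c(3)[OF that(2)]] that(3)
      by simp
    ultimately show ?thesis using c(3)[OF that(1)] rmodule_iso_trans by blast
  qed
  with c(1) show ?thesis by (intro exI[of _ c]) auto
qed

end

theorem proposition2p20: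
  fixes R :: "('r, 'x) ring_scheme" and M :: "('m, 'r, 'y) rmodule_scheme"
  assumes "ring R" and "right_module R M" and "semisimple_rmodule R M"
  shows "has_wdim R M \<longleftrightarrow>
    (\<exists>(n :: nat) (H :: nat \<Rightarrow> 'm set).
       internal_direct_sum R M {..<n} H \<and>
       (\<forall>i<n. homogeneous_semisimple R (submod M (H i))))"
proof -
  obtain \<A> where \<A>: "\<forall>S\<in>\<A>. simple_rmodule R (submod M S)" "internal_direct_sum R M \<A> (\<lambda>S. S)"
    using assms(3) by (auto simp: semisimple_rmodule_def)
  interpret right_module R M by fact
  interpret simple_decomposition R M \<A>
    by unfold_locales (use \<A> in auto)
  show ?thesis
  proof
    assume "has_wdim R M"
    then show "\<exists>(n :: nat) H. internal_direct_sum R M {..<n} H \<and>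
        (\<forall>i<n. homogeneous_semisimple R (submod M (H i)))"
      by (intro homogeneous_decomposition finitely_many_types_if_has_wdim)
  next
    assume "\<exists>(n :: nat) H. internal_direct_sum R M {..<n} H \<and>
        (\<forall>i<n. homogeneous_semisimple R (submod M (H i)))"
    then obtain n c where "\<And>S. S \<in> \<A> \<Longrightarrow> c S < (n :: nat)"
      "\<And>S T. S \<in> \<A> \<Longrightarrow> T \<in> \<A> \<Longrightarrow> c S = c T \<Longrightarrow> rmodule_iso R (submod M S) (submod M T)"
      using finite_iso_types_if_homogeneous_decomposition by metis
    then show "has_wdim R M" by (rule has_wdim_if_finitely_many_types)
  qed
qed

end
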